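(* Let $K_1$ and $K_2$ be cones in $\mathbb{R}^{N_1}$ and $\mathbb{R}^{N_2}$, respectively. Let $\{\mu_u\colon u\in K_2\}$ be a $K_2$-parameter convolution semigroup on $\mathbb{R}^d$, let $\{\rho_s\colon s\in K_1\}$ be a $K_1$-parameter convolution semigroup on $\mathbb{R}^{N_2}$ supported on $K_2$, and let $\{\sigma_s\colon s\in K_1\}$ be the $K_1$-parameter convolution semigroup on $\mathbb{R}^d$ obtained by subordination of $\{\mu_u\}$ by $\{\rho_s\}$, i.e. $\sigma_s(B)=\int_{K_2}\mu_u(B)\,\rho_s(du)$ for Borel $B\subseteq\mathbb{R}^d$. Suppose that there are $0<\alpha\le 2$ and $b>1$ such that, for every $u\in K_2$, $\mu_u$ is strictly $\alpha$-semistable with a span $b^{1/\alpha}$. Fix $s\in K_1$. Then the following statements are true. (i) Let $m\in\{0,1,\ldots,\infty\}$. If $\rho_s\in L_m(b^{-1},\mathbb{R}^{N_2})$, then $\sigma_s\in L_m(b^{-1/\alpha},\mathbb{R}^d)$. (ii) Let $0<\alpha'\le 1$. If $\rho_s$ is strictly $\alpha'$-semistable with a span $b$, then $\sigma_s$ is strictly $\alpha\alpha'$-semistable with a span $b^{1/\alpha}$.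
   Context: A subset $K$ of $\mathbb{R}^N$ is called a cone if it is a non-empty closed convex set, closed under multiplication by nonnegative reals, contains no straight line through $0$, and $K\neq\{0\}$. Given a cone $K$, a $K$-parameter convolution semigroup on $\mathbb{R}^d$ is a family $\{\mu_s\colon s\in K\}$ of probability measures on $\mathbb{R}^d$ such that $\mu_{s_1}*\mu_{s_2}=\mu_{s_1+s_2}$ for all $s_1,s_2\in K$, and $\mu_{ts}\to\delta_0$ weakly as $t\downarrow 0$ for each $s\in K$. It is supported on a set $K'$ if $\mathrm{Supp}(\mu_s)\subseteq K'$ for all $s\in K$. Subordination: if $\{\mu_u\colon u\in K_2\}$ is a $K_2$-parameter convolution semigroup on $\mathbb{R}^d$ and $\{\rho_s\colon s\in K_1\}$ is a $K_1$-parameter convolution semigroup on $\mathbb{R}^{N_2}$ supported on $K_2\subseteq\mathbb{R}^{N_2}$, then the measures $\sigma_s(B)=\int_{K_2}\mu_u(B)\,\rho_s(du)$, $B$ Borel in $\mathbb{R}^d$, form a $K_1$-parameter convolution semigroup on $\mathbb{R}^d$, called subordinated. $\widehat\mu$ denotes the characteristic function of $\mu$, and $ID(\mathbb{R}^d)$ is the class of infinitely divisible distributions on $\mathbb{R}^d$. For $\mu\in ID(\mathbb{R}^d)$ and real $t\ge0$, $\widehat\mu(z)^t$ denotes the characteristic function of the $t$-th convolution power $\mu^t$ of $\mu$ (i.e. $e^{t\log\widehat\mu(z)}$ with the continuous logarithm vanishing at $z=0$). Classes $L_m(b^{-1},\mathbb{R}^d)$, for $b>1$: $L_0(b^{-1},\mathbb{R}^d)$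 is the class of distributions $\mu$ on $\mathbb{R}^d$ for which there is $\mu'\in ID(\mathbb{R}^d)$ with $\widehat\mu(z)=\widehat\mu(b^{-1}z)\,\widehat{\mu'}(z)$ for all $z\in\mathbb{R}^d$ (semi-selfdecomposable distributions with $b$ as a span). Such $\mu$ is infinitely divisible and $\mu'$ is uniquely determined by $\mu$ and $b$. For integers $m\ge1$, inductively, $L_m(b^{-1},\mathbb{R}^d)=\{\mu\in L_0(b^{-1},\mathbb{R}^d)\colon \mu'\in L_{m-1}(b^{-1},\mathbb{R}^d)\}$. Finally $L_\infty(b^{-1},\mathbb{R}^d)=\bigcap_{m=0}^{\infty}L_m(b^{-1},\mathbb{R}^d)$. (Thus $L_m(b^{-1/\alpha},\mathbb{R}^d)$ is the class with $b$ replaced by $b^{1/\alpha}$.) For $0<\alpha\le2$, a distribution $\mu$ on $\mathbb{R}^d$ is strictly $\alpha$-semistable with a span $b>1$ if $\mu\in ID(\mathbb{R}^d)$ and $\widehat\mu(z)^{b^\alpha}=\widehat\mu(bz)$ for all $z\in\mathbb{R}^d$. *)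

theory Defs
  imports "HOL-Probability.Probability" "HOL-Library.Extended_Nat"
begin

definition param_cone :: "'a::euclidean_space set \<Rightarrow> bool" where
  "param_cone K \<longleftrightarrow> K \<noteq> {} \<and> closed K \<and> convex K \<and> cone K \<and>
     \<not> (\<exists>v. v \<noteq> 0 \<and> (\<forall>t::real. t *\<^sub>R v \<in> K)) \<and> K \<noteq> {0}"

definition distributions :: "'a::euclidean_space measure set" where
  "distributions = {M. prob_space M \<and> sets M = sets borel}"

definition Supp :: "'a::euclidean_space measure \<Rightarrow> 'a set" where
  "Supp M = {x. \<forall>U. open U \<longrightarrow> x \<in> U \<longrightarrow> emeasure M U > 0}"

definition weakly_tendsto ::
    "('i \<Rightarrow> 'a::euclidean_space measure) \<Rightarrow> 'a measure \<Rightarrow> 'i filter \<Rightarrow> bool" where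
  "weakly_tendsto M N F \<longleftrightarrow>
     (\<forall>f::'a \<Rightarrow> real. continuous_on UNIV f \<longrightarrow> bounded (range f) \<longrightarrow>
        ((\<lambda>i. \<integral>x. f x \<partial>M i) \<longlongrightarrow> (\<integral>x. f x \<partial>N)) F)"

definition conv_semigroup ::
    "'b::euclidean_space set \<Rightarrow> ('b \<Rightarrow> 'a::ordered_euclidean_space measure) \<Rightarrow> bool" where
  "conv_semigroup K \<mu> \<longleftrightarrow>
     (\<forall>s\<in>K. \<mu> s \<in> distributions) \<and>
     (\<forall>s1\<in>K. \<forall>s2\<in>K. (\<mu> s1 \<star> \<mu> s2) = \<mu> (s1 + s2)) \<and>
     (\<forall>s\<in>K. weakly_tendsto (\<lambda>t::real. \<mu> (t *\<^sub>R s)) (return borel 0) (at_right 0))"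

definition supported_on ::
    "'b::euclidean_space set \<Rightarrow> ('b \<Rightarrow> 'a::euclidean_space measure) \<Rightarrow> 'a set \<Rightarrow> bool" where
  "supported_on K \<rho> K' \<longleftrightarrow> (\<forall>s\<in>K. Supp (\<rho> s) \<subseteq> K')"

(* The integrand is Borel on K2: if K2 is a cone and \<mu> is a convolution semigroup on it, the
   continuous logarithm of the characteristic function of \<mu> u is the restriction to K2 of a
   map linear in u, so \<mu> is weakly continuous on K2. *)
definition subordinated ::
    "'b::euclidean_space set \<Rightarrow> 'c::euclidean_space set \<Rightarrow> ('c \<Rightarrow> 'a::euclidean_space measure) \<Rightarrow>
     ('b \<Rightarrow> 'c measure) \<Rightarrow> ('b \<Rightarrow> 'a measure) \<Rightarrow> bool" where
  "subordinated K1 K2 \<mu> \<rho> \<sigma> \<longleftrightarrow>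
     (\<forall>s\<in>K1. sets (\<sigma> s) = sets borel \<and>
        (\<forall>B\<in>sets borel. emeasure (\<sigma> s) B = (\<integral>\<^sup>+u\<in>K2. emeasure (\<mu> u) B \<partial>\<rho> s)))"

definition char_fun :: "'a::euclidean_space measure \<Rightarrow> 'a \<Rightarrow> complex" where
  "char_fun M z = (CLINT x|M. iexp (z \<bullet> x))"

primrec conv_power :: "'a::ordered_euclidean_space measure \<Rightarrow> nat \<Rightarrow> 'a measure" where
  "conv_power M 0 = return borel 0"
| "conv_power M (Suc n) = (M \<star> conv_power M n)"

definition ID :: "'a::ordered_euclidean_space measure set" where
  "ID = {M \<in> distributions. \<forall>n>0. \<exists>N\<in>distributions. conv_power N n = M}"

(* Meaningful when char_fun M has no zero (in particular for M in ID): then the continuous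
   logarithm on the whole space vanishing at 0 exists and is unique. *)
definition char_log :: "'a::euclidean_space measure \<Rightarrow> 'a \<Rightarrow> complex" where
  "char_log M = (THE g. continuous_on UNIV g \<and> g 0 = 0 \<and> (\<forall>z. exp (g z) = char_fun M z))"

definition char_pow :: "'a::euclidean_space measure \<Rightarrow> real \<Rightarrow> 'a \<Rightarrow> complex" where
  "char_pow M t z = exp (complex_of_real t * char_log M z)"

(* In the classes below c stands for the reciprocal of the span, so 0 < c < 1. *)
definition semi_sd_factor ::
    "real \<Rightarrow> 'a::euclidean_space measure \<Rightarrow> 'a measure \<Rightarrow> bool" where
  "semi_sd_factor c M M' \<longleftrightarrow> (\<forall>z. char_fun M z = char_fun M (c *\<^sub>R z) * char_fun M' z)"

definition semi_selfdecomposable :: "real \<Rightarrow> 'a::ordered_euclidean_space measure set" where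
  "semi_selfdecomposable c = {M \<in> distributions. \<exists>M'\<in>ID. semi_sd_factor c M M'}"

(* M' is uniquely determined by M and c, since char_fun M has no zero; so the existential
   quantifier in the second equation speaks about the factor of M. *)
primrec L_fin :: "nat \<Rightarrow> real \<Rightarrow> 'a::ordered_euclidean_space measure set" where
  "L_fin 0 c = semi_selfdecomposable c"
| "L_fin (Suc m) c =
     {M \<in> semi_selfdecomposable c. \<exists>M'\<in>ID. semi_sd_factor c M M' \<and> M' \<in> L_fin m c}"

definition L_class :: "enat \<Rightarrow> real \<Rightarrow> 'a::ordered_euclidean_space measure set" where
  "L_class m c = (case m of enat n \<Rightarrow> L_fin n c | \<infinity> \<Rightarrow> (\<Inter>n. L_fin n c))"

definition strictly_semistable ::
    "real \<Rightarrow> real \<Rightarrow> 'a::ordered_euclidean_space measure \<Rightarrow> bool" where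
  "strictly_semistable \<alpha> b M \<longleftrightarrow>
     0 < \<alpha> \<and> \<alpha> \<le> 2 \<and> 1 < b \<and> M \<in> ID \<and>
     (\<forall>z. char_pow M (b powr \<alpha>) z = char_fun M (b *\<^sub>R z))"

end

theory Submission
  imports Defs "HOL-Real_Asymp.Real_Asymp"
begin

text \<open>For \<open>u\<close> in the cone, the continuous logarithm of \<open>char_fun (\<mu> u) z\<close> is additive and positively
  homogeneous in \<open>u\<close>, hence the restriction of a linear map. So \<open>u \<mapsto> char_fun (\<mu> u) z\<close> extends to a
  bounded continuous function \<open>ext z\<close>, which makes \<open>\<mu>\<close> a Markov kernel, and the subordinated measure of
  \<open>\<nu>\<close> has characteristic function \<open>\<integral>u. ext z u \<partial>\<nu>\<close>. By multiplicativity in \<open>u\<close>, subordination turns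
  convolutions of measures carried by the cone into convolutions, and by semistability it turns
  dilation by \<open>b\<close> into dilation by \<open>b powr (1/\<alpha>)\<close>. Part (i) then reduces to the fact that
  convolution roots and semi-selfdecomposability factors of measures carried by the cone are again
  carried by it, which is checked on half-spaces. In part (ii), the real convolution power of
  \<open>\<rho> s\<close> is the member \<open>\<rho> (t *\<^sub>R s)\<close> of the semigroup, so no continuity theorem is needed.\<close>

lemma distributionsD:
  assumes "M \<in> distributions"
  shows "prob_space M" "sets M = sets borel" "space M = UNIV"
  using assms by (auto simp: distributions_def dest: sets_eq_imp_space_eq)

lemma distributions_eq_space_prob_algebra: "distributions = space (prob_algebra borel)"
  by (auto simp: distributions_def space_prob_algebra)

section \<open>Characteristic functions determine measures and kernels\<close>

text \<open>Frequencies are arbitrary vectors, so products of monomials are again monomials.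
  Integrals of these functions are finite linear combinations of values of the characteristic
  function.\<close>

inductive trig_poly :: "('a::euclidean_space \<Rightarrow> complex) \<Rightarrow> bool" where
  monomial: "trig_poly (\<lambda>x. c * iexp (z \<bullet> x))"
| add: "trig_poly p \<Longrightarrow> trig_poly q \<Longrightarrow> trig_poly (\<lambda>x. p x + q x)"

lemma trig_poly_const: "trig_poly (\<lambda>x. c)"
  using trig_poly.monomial[of c 0] by simp

lemma trig_poly_monomial_mult: "trig_poly q \<Longrightarrow> trig_poly (\<lambda>x. c * iexp (z \<bullet> x) * q x)"
proof (induction rule: trig_poly.induct)
  case (monomial c' z')
  have "(\<lambda>x. c * iexp (z \<bullet> x) * (c' * iexp (z' \<bullet> x))) = (\<lambda>x. (c * c') * iexp ((z + z') \<bullet> x))"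
    by (simp add: inner_add_left exp_add algebra_simps)
  then show ?case using trig_poly.monomial[of "c * c'" "z + z'"] by simp
next
  case (add p q)
  then show ?case by (simp add: distrib_left trig_poly.add)
qed

lemma trig_poly_mult: "trig_poly p \<Longrightarrow> trig_poly q \<Longrightarrow> trig_poly (\<lambda>x. p x * q x)"
  by (induction rule: trig_poly.induct) (simp_all add: trig_poly_monomial_mult distrib_right trig_poly.add)

lemma trig_poly_sum:
  assumes "finite A" "\<And>i. i \<in> A \<Longrightarrow> trig_poly (p i)"
  shows "trig_poly (\<lambda>x. \<Sum>i\<in>A. p i x)"
  using assms by (induction A rule: finite_induct) (simp_all add: trig_poly_const trig_poly.add)

lemma trig_poly_sin: "trig_poly (\<lambda>x. complex_of_real (sin (z \<bullet> x)))"
proof -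
  have "(\<lambda>x. complex_of_real (sin (z \<bullet> x))) =
     (\<lambda>x. 1 / (2 * \<i>) * iexp (z \<bullet> x) + (- 1 / (2 * \<i>)) * iexp ((- z) \<bullet> x))"
    by (rule ext) (simp add: sin_of_real[symmetric] sin_exp_eq field_simps)
  then show ?thesis
    by (simp only: trig_poly.intros)
qed

text \<open>Trigonometric polynomials form an algebra containing constants and sines, and a linear
  form of a vector of sines is a linear combination of these sines.\<close>

lemma trig_poly_polynomial_sin:
  assumes "real_polynomial_function p"
  shows "trig_poly (\<lambda>x. complex_of_real (p (\<Sum>i\<in>Basis. sin ((r *\<^sub>R i) \<bullet> x) *\<^sub>R i)))"
  using assms
proof (induction rule: real_polynomial_function.induct)
  case (linear f)
  interpret bounded_linear f by fact
  have "trig_poly (\<lambda>x. \<Sum>i\<in>Basis. complex_of_real (f i) * complex_of_real (sin ((r *\<^sub>R i) \<bullet> x)))"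
    by (intro trig_poly_sum trig_poly_mult trig_poly_const trig_poly_sin finite_Basis)
  then show ?case by (simp add: sum scaleR mult.commute)
qed (simp_all add: trig_poly_const trig_poly.add trig_poly_mult)

text \<open>As \<open>n * sin (x / n)\<close> tends to \<open>x\<close>, the composition of \<open>f\<close> with this map in every coordinate
  tends to \<open>f\<close>, and it is a continuous function of sines, to which Stone-Weierstrass applies.\<close>

lemma trig_poly_approx:
  fixes f :: "'a::euclidean_space \<Rightarrow> real"
  assumes f: "continuous_on UNIV f" and C: "\<And>x. \<bar>f x\<bar> \<le> C"
  obtains T where "\<And>n. trig_poly (T n)" "\<And>n x. norm (T n x) \<le> C + 1"
    "\<And>x. (\<lambda>n. T n x) \<longlonglongrightarrow> complex_of_real (f x)"
proof -
  \<comment> \<open>All vectors of sines lie in this compact cube, so approximation there is enough.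
    The error \<open>1 / Suc n\<close> is at most 1, whence the uniform bound
    \<open>C + 1\<close>.\<close>
  define B where "B = cbox (- One) (One::'a)"
  have "\<exists>p. real_polynomial_function p \<and> (\<forall>y\<in>B. \<bar>f (real (Suc n) *\<^sub>R y) - p y\<bar> < 1 / Suc n)" for n
  proof -
    have "continuous_on B (\<lambda>y. f (real (Suc n) *\<^sub>R y))"
      by (rule continuous_on_compose2[OF f]) (auto intro!: continuous_intros)
    then show ?thesis
      by (rule Stone_Weierstrass_real_polynomial_function[of B, rotated, of _ "1 / Suc n"])
        (auto simp: B_def)
  qed
  then obtain p where p: "\<And>n. real_polynomial_function (p n)"
     "\<And>n y. y \<in> B \<Longrightarrow> \<bar>f (real (Suc n) *\<^sub>R y) - p n y\<bar> < 1 / Suc n" by metis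
  define S where "S n x = (\<Sum>i\<in>Basis. sin (((1 / Suc n) *\<^sub>R i) \<bullet> x) *\<^sub>R i)" for n and x :: 'a
  define T where "T n x = complex_of_real (p n (S n x))" for n x
  have S: "S n x \<in> B" for n x
    by (auto simp: S_def B_def mem_box inner_sum_left inner_Basis if_distrib cong: if_cong)
  have lim: "(\<lambda>n. f (real (Suc n) *\<^sub>R S n x)) \<longlonglongrightarrow> f x" for x
  proof -
    have "(\<lambda>n. real (Suc n) *\<^sub>R S n x) \<longlonglongrightarrow> (\<Sum>i\<in>Basis. (i \<bullet> x) *\<^sub>R i)"
      unfolding S_def scaleR_sum_right scaleR_scaleR
    proof (intro tendsto_sum tendsto_scaleR tendsto_const)
      fix i :: 'a
      have "(\<lambda>n. real n * sin ((i \<bullet> x) / real n)) \<longlonglongrightarrow> i \<bullet> x"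
        by real_asymp
      from LIMSEQ_Suc[OF this]
      show "(\<lambda>n. real (Suc n) * sin ((1 / real (Suc n)) *\<^sub>R i \<bullet> x)) \<longlonglongrightarrow> i \<bullet> x" by simp
    qed
    also have "(\<Sum>i\<in>Basis. (i \<bullet> x) *\<^sub>R i) = x" by (simp add: inner_commute[of _ x] euclidean_representation)
    finally show ?thesis
      using f by (auto intro: continuous_on_tendsto_compose)
  qed
  show thesis
  proof
    show "trig_poly (T n)" for n
      unfolding T_def S_def by (intro trig_poly_polynomial_sin p)
    show "norm (T n x) \<le> C + 1" for n x
    proof -
      have "\<bar>f (real (Suc n) *\<^sub>R S n x) - p n (S n x)\<bar> \<le> 1"
        using p(2)[OF S, of n n x] by (rule order.trans[OF less_imp_le]) simp
      with C[of "real (Suc n) *\<^sub>R S n x"] show ?thesis by (simp add: T_def)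
    qed
    show "(\<lambda>n. T n x) \<longlonglongrightarrow> complex_of_real (f x)" for x
    proof -
      have "(\<lambda>n. f (real (Suc n) *\<^sub>R S n x) - p n (S n x)) \<longlonglongrightarrow> 0"
        by (rule Lim_null_comparison[OF _ LIMSEQ_Suc[OF lim_inverse_n']])
          (use p(2)[OF S] in \<open>auto intro!: always_eventually less_imp_le\<close>)
      from tendsto_diff[OF lim this, of x] have "(\<lambda>n. p n (S n x)) \<longlonglongrightarrow> f x"
        by (simp add: diff_diff_eq2)
      then show ?thesis by (simp add: T_def tendsto_of_real_iff)
    qed
  qed
qed

lemma trig_poly_measurable: "trig_poly p \<Longrightarrow> p \<in> borel_measurable borel"
  by (induction rule: trig_poly.induct) measurable

lemma integrable_iexp_inner:
  assumes "M \<in> distributions"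
  shows "integrable M (\<lambda>x. iexp (z \<bullet> x))"
proof -
  interpret prob_space M using assms by (rule distributionsD)
  have [measurable_cong]: "sets M = sets borel" using assms by (rule distributionsD)
  show ?thesis by (intro integrable_iexp) auto
qed

lemma trig_poly_integrable: "trig_poly p \<Longrightarrow> M \<in> distributions \<Longrightarrow> integrable M p"
  by (induction rule: trig_poly.induct)
    (simp_all add: integrable_iexp_inner Bochner_Integration.integrable_add)

lemma trig_poly_integral_measurable:
  assumes "trig_poly p" "\<And>a. a \<in> space A \<Longrightarrow> k a \<in> distributions"
    and "\<And>z. (\<lambda>a. char_fun (k a) z) \<in> borel_measurable A"
  shows "(\<lambda>a. \<integral>x. p x \<partial>k a) \<in> borel_measurable A"
  using assms(1)
proof (induction rule: trig_poly.induct)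
  case (monomial c z)
  show ?case using assms(3) by (simp add: char_fun_def[symmetric])
next
  case (add p q)
  have "(\<integral>x. p x + q x \<partial>k a) = (\<integral>x. p x \<partial>k a) + (\<integral>x. q x \<partial>k a)" if "a \<in> space A" for a
    using add.hyps assms(2)[OF that] by (intro Bochner_Integration.integral_add trig_poly_integrable)
  with add.IH show ?case by (simp cong: measurable_cong)
qed

text \<open>The distance to the complement, multiplied by \<open>n\<close> and cut off at 1,
  vanishes off \<open>U\<close> and is eventually 1 at each point of \<open>U\<close>.\<close>

lemma open_indicator_approx:
  fixes U :: "'a::metric_space set"
  assumes "open U"
  obtains f :: "nat \<Rightarrow> 'a \<Rightarrow> real" where "\<And>n. continuous_on UNIV (f n)" "\<And>n x. \<bar>f n x\<bar> \<le> 1"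
    "\<And>x. (\<lambda>n. f n x) \<longlonglongrightarrow> indicator U x"
\<comment> \<open>The distance to the empty complement has the default value 0, so this case is
  separate.\<close>
proof (cases "U = UNIV")
  case True
  then show ?thesis by (intro that[of "\<lambda>_ _. 1"]) auto
next
  case False
  show ?thesis
  proof
    let ?f = "\<lambda>n x. min 1 (real n * infdist x (- U))"
    show "continuous_on UNIV (?f n)" for n by (intro continuous_intros)
    show "\<bar>?f n x\<bar> \<le> 1" for n x by (auto simp: infdist_nonneg min_def)
    show "(\<lambda>n. ?f n x) \<longlonglongrightarrow> indicator U x" for x
    proof (cases "x \<in> U")
      case True
      then have "0 < infdist x (- U)"
        using assms False infdist_pos_not_in_closed[of "- U" x] by auto
      then have "(\<lambda>n. ?f n x) \<longlonglongrightarrow> 1" by real_asymp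
      with True show ?thesis by simp
    qed simp
  qed
qed

lemma integral_bounded_convergence:
  fixes g :: "nat \<Rightarrow> 'a::euclidean_space \<Rightarrow> 'b::{banach, second_countable_topology}"
  assumes "M \<in> distributions" "\<And>n. g n \<in> borel_measurable borel" "\<And>n x. norm (g n x) \<le> C"
    "\<And>x. (\<lambda>n. g n x) \<longlonglongrightarrow> h x"
  shows "(\<lambda>n. \<integral>x. g n x \<partial>M) \<longlonglongrightarrow> (\<integral>x. h x \<partial>M)"
proof -
  interpret prob_space M using assms(1) by (rule distributionsD)
  have [measurable_cong]: "sets M = sets borel" using assms(1) by (rule distributionsD)
  note assms(2)[measurable]
  have [measurable]: "h \<in> borel_measurable borel"
    using assms(4,2) by (rule borel_measurable_LIMSEQ_metric[rotated])
  show ?thesis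
    using assms(3,4) by (intro integral_dominated_convergence[where w="\<lambda>_. C"]) auto
qed

text \<open>Open sets form an intersection-stable generator, so their masses suffice. The indicator
  of an open set is a limit of bounded continuous functions, and these are limits of trigonometric
  polynomials; bounded convergence carries measurability through both limits.\<close>

lemma kernel_measurable_char_fun:
  fixes k :: "'b \<Rightarrow> 'a::euclidean_space measure"
  assumes k: "\<And>a. a \<in> space A \<Longrightarrow> k a \<in> distributions"
    and cf: "\<And>z. (\<lambda>a. char_fun (k a) z) \<in> borel_measurable A"
  shows "k \<in> A \<rightarrow>\<^sub>M prob_algebra borel"
proof (rule measurable_prob_algebra_generated)
  show "sets borel = sigma_sets (UNIV :: 'a set) {U. open U}" by (simp add: borel_def)
  show "Int_stable {U :: 'a set. open U}" by (auto simp: Int_stable_def)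
  show "{U :: 'a set. open U} \<subseteq> Pow UNIV" by simp
  show "prob_space (k a)" "sets (k a) = sets borel" if "a \<in> space A" for a
    using distributionsD[OF k[OF that]] by auto
  fix U :: "'a set" assume "U \<in> {U. open U}"
  then have U: "open U" by simp
  have cont: "(\<lambda>a. \<integral>x. f x \<partial>k a) \<in> borel_measurable A"
    if f: "continuous_on UNIV f" "\<And>x. \<bar>f x\<bar> \<le> C" for f :: "'a \<Rightarrow> real" and C
  proof -
    obtain T where T: "\<And>n. trig_poly (T n)" "\<And>n x. norm (T n x) \<le> C + 1"
        "\<And>x. (\<lambda>n. T n x) \<longlonglongrightarrow> complex_of_real (f x)"
      using trig_poly_approx[OF f] by blast
    have "(\<lambda>a. \<integral>x. complex_of_real (f x) \<partial>k a) \<in> borel_measurable A"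
      using trig_poly_integral_measurable[OF T(1) k cf]
    proof (rule borel_measurable_LIMSEQ_metric)
      fix a assume "a \<in> space A"
      then show "(\<lambda>n. \<integral>x. T n x \<partial>k a) \<longlonglongrightarrow> (\<integral>x. complex_of_real (f x) \<partial>k a)"
        using T by (intro integral_bounded_convergence k trig_poly_measurable)
    qed
    then have "(\<lambda>a. Re (\<integral>x. complex_of_real (f x) \<partial>k a)) \<in> borel_measurable A" by measurable
    then show ?thesis by simp
  qed
  obtain f :: "nat \<Rightarrow> 'a \<Rightarrow> real" where f: "\<And>n. continuous_on UNIV (f n)" "\<And>n x. \<bar>f n x\<bar> \<le> 1"
    "\<And>x. (\<lambda>n. f n x) \<longlonglongrightarrow> indicator U x"
    using open_indicator_approx[OF U] by blast
  have "(\<lambda>a. \<integral>x. indicator U x \<partial>k a :: real) \<in> borel_measurable A"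
    using cont[OF f(1,2)]
  proof (rule borel_measurable_LIMSEQ_metric)
    fix a assume "a \<in> space A"
    then show "(\<lambda>n. \<integral>x. f n x \<partial>k a) \<longlonglongrightarrow> (\<integral>x. indicator U x \<partial>k a)"
      using f by (intro integral_bounded_convergence[where C=1] k borel_measurable_continuous_onI) auto
  qed
  then have "(\<lambda>a. ennreal (measure (k a) U)) \<in> borel_measurable A"
    using distributionsD[OF k] by (simp cong: measurable_cong)
  then show "(\<lambda>a. emeasure (k a) U) \<in> borel_measurable A"
    using distributionsD(1)[OF k] by (simp add: prob_space_def finite_measure.emeasure_eq_measure cong: measurable_cong)
qed

text \<open>Measurability is tested over a two-point space with the trivial \<open>\<sigma>\<close>-algebra, on which
  every measurable function is constant.\<close>

lemma char_fun_inject: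
  assumes M: "M \<in> distributions" and N: "N \<in> distributions"
    and eq: "\<And>z. char_fun M z = char_fun N z"
  shows "M = N"
proof (rule measure_eqI)
  show "sets M = sets N" using M N by (simp add: distributionsD)
  fix X assume "X \<in> sets M"
  then have [measurable]: "X \<in> sets borel" using M by (simp add: distributionsD)
  let ?A = "sigma (UNIV :: bool set) {}" and ?k = "\<lambda>i. if i then M else N"
  have "(\<lambda>i. char_fun (?k i) z) = (\<lambda>i. char_fun N z)" for z by (auto simp: eq)
  then have "?k \<in> ?A \<rightarrow>\<^sub>M prob_algebra borel"
    using M N by (intro kernel_measurable_char_fun) auto
  then have "?k \<in> ?A \<rightarrow>\<^sub>M subprob_algebra borel" by (rule measurable_prob_algebraD)
  then have "(\<lambda>i. emeasure (?k i) X) \<in> borel_measurable ?A" by (rule measurable_emeasure_kernel) simp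
  then have "(\<lambda>i. emeasure (?k i) X) -` {emeasure M X} \<inter> space ?A \<in> sets ?A"
    by (rule measurable_sets) simp
  then have "(\<lambda>i. emeasure (?k i) X) -` {emeasure M X} \<in> {{}, UNIV}"
    by (simp add: sigma_sets_empty_eq)
  moreover have "True \<in> (\<lambda>i. emeasure (?k i) X) -` {emeasure M X}" by simp
  ultimately have "False \<in> (\<lambda>i. emeasure (?k i) X) -` {emeasure M X}" by blast
  then show "emeasure M X = emeasure N X" by simp
qed

section \<open>Characteristic functions under dilation and convolution\<close>

lemma integrable_bounded_measurable:
  fixes f :: "'a::euclidean_space \<Rightarrow> 'b::{banach, second_countable_topology}"
  assumes "M \<in> distributions" "f \<in> borel_measurable borel" "\<And>x. norm (f x) \<le> C"
  shows "integrable M f"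
proof -
  interpret prob_space M using assms(1) by (rule distributionsD)
  have [measurable_cong]: "sets M = sets borel" using assms(1) by (rule distributionsD)
  note assms(2)[measurable]
  show ?thesis using assms(3) by (intro integrable_const_bound[of _ C]) auto
qed

lemma char_fun_0: "M \<in> distributions \<Longrightarrow> char_fun M 0 = 1"
  using distributionsD(1)[of M] by (simp add: char_fun_def prob_space.prob_space)

lemma continuous_char_fun: "M \<in> distributions \<Longrightarrow> continuous_on S (char_fun M)"
  unfolding continuous_on_sequentially comp_def char_fun_def
  by (auto intro!: integral_bounded_convergence[where C=1] tendsto_intros)

lemma norm_char_fun_le_1:
  assumes "M \<in> distributions"
  shows "norm (char_fun M z) \<le> 1"
proof -
  interpret prob_space M using assms by (rule distributionsD)
  have "norm (char_fun M z) \<le> (\<integral>x. norm (iexp (z \<bullet> x)) \<partial>M)"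
    unfolding char_fun_def by (rule integral_norm_bound)
  also have "\<dots> = 1" by (simp add: prob_space)
  finally show ?thesis .
qed

lemma return_0_distributions: "return borel 0 \<in> distributions"
  by (simp add: distributions_def prob_space_return)

lemma char_fun_return_0: "char_fun (return borel 0) z = 1"
  by (simp add: char_fun_def integral_return)

lemma distr_distributions:
  "M \<in> distributions \<Longrightarrow> f \<in> borel_measurable borel \<Longrightarrow> distr M borel f \<in> distributions"
  by (auto simp: distributions_def intro!: prob_space.prob_space_distr cong: measurable_cong_sets)

lemma char_fun_distr_scaleR:
  assumes "M \<in> distributions"
  shows "char_fun (distr M borel ((*\<^sub>R) c)) z = char_fun M (c *\<^sub>R z)"
proof -
  have [measurable_cong]: "sets M = sets borel" using assms by (rule distributionsD)
  show ?thesis unfolding char_fun_def by (subst integral_distr) auto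
qed

lemma convolution_distributions:
  assumes "M \<in> distributions" "N \<in> distributions"
  shows "(M \<star> N) \<in> distributions"
proof -
  have [measurable_cong]: "sets M = sets borel" "sets N = sets borel" using assms by (auto dest: distributionsD)
  interpret pair_prob_space M N
    using assms by (simp add: pair_prob_space_def pair_sigma_finite_def distributionsD(1)
      prob_space_imp_sigma_finite)
  show ?thesis
    by (auto simp: distributions_def convolution_def intro!: prob_space_distr)
qed

text \<open>By Fubini. The functional equation is asked on \<open>K\<close> only:
  \<open>K = UNIV\<close> serves the exponentials, a cone serves functions that are multiplicative
  there.\<close>

lemma integral_convolution_mult:
  fixes h :: "'a::ordered_euclidean_space \<Rightarrow> complex"
  assumes M: "M \<in> distributions" and N: "N \<in> distributions"
    and h[measurable]: "h \<in> borel_measurable borel" and bdd: "\<And>x. norm (h x) \<le> C"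
    and K: "AE x in M. x \<in> K" "AE x in N. x \<in> K"
    and mult: "\<And>x y. x \<in> K \<Longrightarrow> y \<in> K \<Longrightarrow> h (x + y) = h x * h y"
  shows "(\<integral>x. h x \<partial>(M \<star> N)) = (\<integral>x. h x \<partial>M) * (\<integral>x. h x \<partial>N)"
proof -
  have [measurable_cong]: "sets M = sets borel" "sets N = sets borel" using M N by (auto dest: distributionsD)
  interpret pair_prob_space M N
    using M N by (simp add: pair_prob_space_def pair_sigma_finite_def distributionsD(1)
      prob_space_imp_sigma_finite)
  have int: "integrable (M \<Otimes>\<^sub>M N) (\<lambda>(x, y). h (x + y))"
    using bdd by (intro integrable_const_bound[of _ C]) auto
  have "(\<integral>x. h x \<partial>(M \<star> N)) = (\<integral>p. (\<lambda>(x, y). h (x + y)) p \<partial>(M \<Otimes>\<^sub>M N))"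
    unfolding convolution_def by (subst integral_distr) (auto simp: case_prod_unfold)
  also have "\<dots> = (\<integral>x. (\<integral>y. h (x + y) \<partial>N) \<partial>M)"
    using integral_fst'[OF int] by simp
  also have "\<dots> = (\<integral>x. h x * (\<integral>y. h y \<partial>N) \<partial>M)"
  proof (rule integral_cong_AE)
    show "AE x in M. (\<integral>y. h (x + y) \<partial>N) = h x * (\<integral>y. h y \<partial>N)"
      using K(1)
    proof eventually_elim
      case (elim x)
      have "(\<integral>y. h (x + y) \<partial>N) = (\<integral>y. h x * h y \<partial>N)"
        using K(2) mult elim by (intro integral_cong_AE) auto
      then show ?case by simp
    qed
  qed auto
  finally show ?thesis by simp
qed

lemma char_fun_convolution:
  assumes "M \<in> distributions" "N \<in> distributions"
  shows "char_fun (M \<star> N) z = char_fun M z * char_fun N z"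
  unfolding char_fun_def
  by (rule integral_convolution_mult[OF assms, where K=UNIV and C=1])
    (auto simp: inner_add_right distrib_left exp_add)

lemma conv_power_distributions: "M \<in> distributions \<Longrightarrow> conv_power M n \<in> distributions"
  by (induction n) (auto intro: convolution_distributions return_0_distributions)

lemma char_fun_conv_power: "M \<in> distributions \<Longrightarrow> char_fun (conv_power M n) z = char_fun M z ^ n"
  by (induction n) (auto simp: char_fun_return_0 char_fun_convolution conv_power_distributions)

section \<open>One-parameter semigroups\<close>

text \<open>The values are integer multiples of 2 pi i, so distinct ones are at least 2 pi apart,
  and a continuous function with such a range is constant on a connected set.\<close>

lemma continuous_exp_eq_1_imp_eq:
  fixes h :: "'a::topological_space \<Rightarrow> complex"
  assumes "connected S" "continuous_on S h" "\<And>x. x \<in> S \<Longrightarrow> exp (h x) = 1" "x \<in> S" "y \<in> S"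
  shows "h x = h y"
proof -
  have "h constant_on S"
  proof (rule continuous_discrete_range_constant[OF assms(1,2)])
    fix x assume x: "x \<in> S"
    have "2 * pi \<le> norm (h y - h x)" if y: "y \<in> S" "h y \<noteq> h x" for y
    proof -
      have "exp (h y - h x) = 1" using assms(3) x y by (simp add: exp_diff)
      then obtain n :: int where n: "Re (h y - h x) = 0" "Im (h y - h x) = of_int (2 * n) * pi"
        by (auto simp: exp_eq_1)
      with y have "n \<noteq> 0" by (auto simp: complex_eq_iff)
      then have "1 \<le> \<bar>real_of_int n\<bar>" by linarith
      then have "2 * pi \<le> \<bar>Im (h y - h x)\<bar>" unfolding n by (simp add: abs_mult)
      then show ?thesis using abs_Im_le_cmod order.trans by blast
    qed
    then show "\<exists>e>0. \<forall>y. y \<in> S \<and> h y \<noteq> h x \<longrightarrow> e \<le> norm (h y - h x)"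
      by (intro exI[of _ "2 * pi"]) auto
  qed
  then show ?thesis using assms(4,5) by (auto simp: constant_on_def)
qed

text \<open>The difference of two continuous logarithms has exponential 1, hence is constant, and it
  vanishes at 0.\<close>

lemma char_log_unique:
  fixes g :: "'a::euclidean_space \<Rightarrow> complex"
  assumes "continuous_on UNIV g" "g 0 = 0" "\<And>z. exp (g z) = char_fun M z"
  shows "char_log M = g"
  unfolding char_log_def
proof (rule the_equality)
  fix f assume f: "continuous_on UNIV f \<and> f 0 = 0 \<and> (\<forall>z. exp (f z) = char_fun M z)"
  show "f = g"
  proof
    fix z
    have "f z - g z = f 0 - g 0"
      by (rule continuous_exp_eq_1_imp_eq[where S=UNIV])
        (use f assms in \<open>auto intro!: continuous_intros simp: exp_diff, metis assms(3) exp_not_eq_zero\<close>)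
    then show "f z = g z" using f assms by simp
  qed
qed (use assms in auto)

text \<open>The whole space is contractible, so a nowhere vanishing characteristic function has a
  continuous logarithm \<open>g\<close>. Subtracting \<open>g 0\<close>, whose exponential is 1,
  normalizes it.\<close>

lemma char_log:
  fixes M :: "'a::euclidean_space measure"
  assumes M: "M \<in> distributions" and nz: "\<And>z. char_fun M z \<noteq> 0"
  shows "continuous_on UNIV (char_log M)" "char_log M 0 = 0" "exp (char_log M z) = char_fun M z"
proof -
  obtain g where g: "continuous_on UNIV g" "\<And>z. char_fun M z = exp (g z)"
    using continuous_logarithm_on_contractible[OF continuous_char_fun[OF M] _ nz, of UNIV]
      convex_imp_contractible[OF convex_UNIV] by auto
  have "exp (g 0) = 1" using g(2)[of 0] char_fun_0[OF M] by simp
  then have "char_log M = (\<lambda>z. g z - g 0)"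
    using g by (intro char_log_unique continuous_intros) (auto simp: exp_diff)
  then show "continuous_on UNIV (char_log M)" "char_log M 0 = 0" "exp (char_log M z) = char_fun M z"
    using g \<open>exp (g 0) = 1\<close> by (auto intro!: continuous_intros simp: exp_diff)
qed

text \<open>From \<open>f (s + t) - f s = f s * (f t - 1)\<close> and
  \<open>norm (f s) \<le> 1\<close>, increments over a step \<open>t\<close> are bounded by the
  distance of \<open>f t\<close> to 1, uniformly in \<open>s\<close>; taking the smaller point as
  \<open>s\<close> covers both sides.\<close>

lemma semigroup_continuous:
  fixes f :: "real \<Rightarrow> complex"
  assumes mult: "\<And>s t. 0 \<le> s \<Longrightarrow> 0 \<le> t \<Longrightarrow> f (s + t) = f s * f t"
    and bdd: "\<And>t. 0 \<le> t \<Longrightarrow> norm (f t) \<le> 1"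
    and lim: "(f \<longlongrightarrow> 1) (at_right 0)"
  shows "continuous_on {0..} f"
proof -
  have diff: "dist (f (s + t)) (f s) \<le> dist (f t) 1" if "0 \<le> s" "0 \<le> t" for s t
  proof -
    have "f (s + t) - f s = f s * (f t - 1)" using mult that by (simp add: algebra_simps)
    then have "dist (f (s + t)) (f s) = norm (f s) * dist (f t) 1" by (simp add: dist_norm norm_mult)
    also have "\<dots> \<le> dist (f t) 1" using bdd that by (simp add: mult_left_le_one_le)
    finally show ?thesis .
  qed
  show ?thesis
    unfolding continuous_on_iff
  proof (intro ballI allI impI)
    fix x e :: real assume x: "x \<in> {0..}" and "0 < e"
    then have "\<forall>\<^sub>F t in at_right 0. dist (f t) 1 < e" using lim by (simp add: tendsto_iff)
    then obtain d where d: "0 < d" "\<And>t. 0 < t \<Longrightarrow> t < d \<Longrightarrow> dist (f t) 1 < e"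
      by (auto simp: eventually_at_right_field)
    show "\<exists>d>0. \<forall>y\<in>{0..}. dist y x < d \<longrightarrow> dist (f y) (f x) < e"
    proof (intro exI[of _ d] conjI ballI impI d(1))
      fix y assume y: "y \<in> {0..}" "dist y x < d"
      consider "y = x" | "x < y" | "y < x" by linarith
      then show "dist (f y) (f x) < e"
      proof cases
        case 2
        have "dist (f (x + (y - x))) (f x) \<le> dist (f (y - x)) 1" using x 2 by (intro diff) auto
        also have "\<dots> < e" using y 2 by (intro d) (auto simp: dist_real_def)
        finally show ?thesis by simp
      next
        case 3
        have "dist (f (y + (x - y))) (f y) \<le> dist (f (x - y)) 1" using y 3 by (intro diff) auto
        also have "\<dots> < e" using y 3 by (intro d) (auto simp: dist_real_def)
        finally show ?thesis by (simp add: dist_commute)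
      qed (use \<open>0 < e\<close> in simp)
    qed
  qed
qed

text \<open>The logarithm of \<open>char_fun (\<nu> (1/n))\<close>, multiplied by \<open>n\<close>, is a continuous logarithm of
  \<open>char_fun (\<nu> 1)\<close> and hence equals \<open>char_log (\<nu> 1)\<close>. This gives the claim for rational \<open>t\<close>.\<close>

lemma char_fun_semigroup_eq_char_pow:
  fixes \<nu> :: "real \<Rightarrow> 'a::euclidean_space measure"
  assumes D: "\<And>t. 0 \<le> t \<Longrightarrow> \<nu> t \<in> distributions"
    and mult: "\<And>s t z. 0 \<le> s \<Longrightarrow> 0 \<le> t \<Longrightarrow> char_fun (\<nu> (s + t)) z = char_fun (\<nu> s) z * char_fun (\<nu> t) z"
    and lim: "\<And>z. ((\<lambda>t. char_fun (\<nu> t) z) \<longlongrightarrow> 1) (at_right 0)"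
    and t: "0 \<le> t"
  shows "char_fun (\<nu> t) z = char_pow (\<nu> 1) t z"
proof -
  have cont: "continuous_on {0..} (\<lambda>t. char_fun (\<nu> t) z)" for z
    by (intro semigroup_continuous mult lim norm_char_fun_le_1 D)
  \<comment> \<open>The assumed limit concerns positive \<open>t\<close> only; continuity on the
    closed half-line identifies it with the value at 0.\<close>
  have zero: "char_fun (\<nu> 0) z = 1" for z
  proof -
    have "continuous (at_right 0) (\<lambda>t. char_fun (\<nu> t) z)"
      using cont[of z] by (auto simp: continuous_on_eq_continuous_within intro: continuous_within_subset)
    then have "((\<lambda>t. char_fun (\<nu> t) z) \<longlongrightarrow> char_fun (\<nu> 0) z) (at_right 0)"
      by (simp add: continuous_within)
    from tendsto_unique[OF _ this lim] show ?thesis by simp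
  qed
  have power: "char_fun (\<nu> (real m * s)) z = char_fun (\<nu> s) z ^ m" if "0 \<le> s" for m s z
    using that by (induction m) (simp_all add: zero mult distrib_right)
  have root: "char_fun (\<nu> (1 / real (Suc n))) z ^ Suc n = char_fun (\<nu> 1) z" for n z
    using power[of "1 / real (Suc n)" "Suc n" z] by (simp del: power_Suc of_nat_Suc)
  \<comment> \<open>A zero of one root is a zero of \<open>char_fun (\<nu> 1)\<close> and hence of
    all roots, contradicting their convergence to 1.\<close>
  have nz: "char_fun (\<nu> (1 / real (Suc n))) z \<noteq> 0" for n z
  proof
    assume "char_fun (\<nu> (1 / real (Suc n))) z = 0"
    then have "char_fun (\<nu> 1) z = 0" using root[of n z] by (simp del: of_nat_Suc)
    then have 0: "char_fun (\<nu> (1 / real (Suc n))) z = 0" for n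
      using root[of n z] by (simp del: power_Suc of_nat_Suc)
    have "filterlim (\<lambda>n. 1 / real (Suc n)) (at_right 0) sequentially" by real_asymp
    from filterlim_compose[OF lim this] have "(\<lambda>n. char_fun (\<nu> (1 / real (Suc n))) z) \<longlonglongrightarrow> 1" .
    with 0 show False by (simp del: of_nat_Suc add: LIMSEQ_const_iff)
  qed
  have log: "char_log (\<nu> 1) = (\<lambda>z. of_nat (Suc n) * char_log (\<nu> (1 / real (Suc n))) z)" for n
  proof (rule char_log_unique)
    have dn: "\<nu> (1 / real (Suc n)) \<in> distributions" by (rule D) simp
    note L = char_log[OF dn nz]
    show "continuous_on UNIV (\<lambda>z. of_nat (Suc n) * char_log (\<nu> (1 / real (Suc n))) z)"
      by (intro continuous_intros L)
    show "of_nat (Suc n) * char_log (\<nu> (1 / real (Suc n))) 0 = 0" by (simp only: L mult_zero_right)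
    show "exp (of_nat (Suc n) * char_log (\<nu> (1 / real (Suc n))) z) = char_fun (\<nu> 1) z" for z
      by (simp only: exp_of_nat_mult L root)
  qed
  have frac: "char_fun (\<nu> (real m / real (Suc n))) z = char_pow (\<nu> 1) (real m / real (Suc n)) z" for m n
  proof -
    have "char_fun (\<nu> (real m * (1 / real (Suc n)))) z = exp (of_nat m * char_log (\<nu> (1 / real (Suc n))) z)"
      unfolding exp_of_nat_mult using char_log(3)[OF D nz] by (subst power) simp_all
    also have "of_nat m * char_log (\<nu> (1 / real (Suc n))) z = of_real (real m / real (Suc n)) * char_log (\<nu> 1) z"
      by (subst log[of n]) (simp del: of_nat_Suc)
    finally show ?thesis by (simp add: char_pow_def del: of_nat_Suc)
  qed
  \<comment> \<open>Nonnegative rationals tending to \<open>t\<close>; continuity of both sides in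
    the time parameter extends the identity from these to \<open>t\<close>.\<close>
  define q where "q n = real (nat \<lfloor>real (Suc n) * t\<rfloor>) / real (Suc n)" for n
  have "(\<lambda>n. real_of_int \<lfloor>real (Suc n) * t\<rfloor> / real (Suc n)) \<longlonglongrightarrow> t" by real_asymp
  then have q: "q \<longlonglongrightarrow> t" using t by (simp add: q_def[abs_def])
  have "(\<lambda>n. char_fun (\<nu> (q n)) z) \<longlonglongrightarrow> char_fun (\<nu> t) z"
    using t by (intro continuous_on_tendsto_compose[OF cont q]) (auto simp: q_def)
  moreover have "(\<lambda>n. char_pow (\<nu> 1) (q n) z) \<longlonglongrightarrow> char_pow (\<nu> 1) t z"
    unfolding char_pow_def by (intro tendsto_intros q)
  moreover have "char_fun (\<nu> (q n)) z = char_pow (\<nu> 1) (q n) z" for n unfolding q_def by (rule frac)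
  ultimately show ?thesis using LIMSEQ_unique by auto
qed

text \<open>The exponent is the right derivative at 0. Using all \<open>t\<close> removes the 2 pi i
  ambiguity that a single value of \<open>t\<close> would leave.\<close>

lemma complex_exp_semigroup_inject:
  assumes eq: "\<And>t. 0 \<le> t \<Longrightarrow> exp (complex_of_real t * a) = exp (complex_of_real t * b)"
  shows "a = b"
proof -
  have deriv: "((\<lambda>t. exp (complex_of_real t * c)) has_vector_derivative c) (at 0 within {0..})" for c
    using exp_scaleR_has_vector_derivative_right[of c 0 "{0..}"] by (simp add: scaleR_conv_of_real)
  show ?thesis
  proof (rule vector_derivative_unique_within)
    show "at 0 within {0::real..} \<noteq> bot" by (simp add: at_within_Ici_at_right)
    show "((\<lambda>t. exp (complex_of_real t * b)) has_vector_derivative a) (at 0 within {0..})"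
      by (rule has_vector_derivative_transform[OF _ _ deriv]) (simp_all add: eq)
    show "((\<lambda>t. exp (complex_of_real t * b)) has_vector_derivative b) (at 0 within {0..})"
      by (rule deriv)
  qed
qed

text \<open>Take a basis of the span of \<open>K\<close> inside \<open>K\<close> and extend
  \<open>f\<close> linearly from it. Agreement passes to nonnegative combinations of the basis, and
  every point of \<open>K\<close> is a difference of two of these.\<close>

lemma additive_on_cone_imp_linear:
  fixes f :: "'a::euclidean_space \<Rightarrow> 'b::real_vector"
  assumes ne: "K \<noteq> {}"
    and add: "\<And>u v. u \<in> K \<Longrightarrow> v \<in> K \<Longrightarrow> u + v \<in> K" and scale: "\<And>c u. 0 \<le> c \<Longrightarrow> u \<in> K \<Longrightarrow> c *\<^sub>R u \<in> K"
    and f_add: "\<And>u v. u \<in> K \<Longrightarrow> v \<in> K \<Longrightarrow> f (u + v) = f u + f v"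
    and f_scale: "\<And>c u. 0 \<le> c \<Longrightarrow> u \<in> K \<Longrightarrow> f (c *\<^sub>R u) = c *\<^sub>R f u"
  obtains g where "linear g" "\<And>u. u \<in> K \<Longrightarrow> g u = f u"
proof -
  obtain B where B: "B \<subseteq> K" "independent B" "K \<subseteq> span B" by (rule maximal_independent_subset)
  obtain g where g: "linear g" "\<And>b. b \<in> B \<Longrightarrow> g b = f b"
    using linear_independent_extend[OF B(2), of f] by auto
  have fin: "finite B" using B(2) by (rule finiteI_independent)
  obtain u0 where "u0 \<in> K" using ne by auto
  from scale[OF _ this, of 0] f_scale[OF _ this, of 0] have zero: "0 \<in> K" "f 0 = 0" by auto
  have comb: "(\<Sum>b\<in>A. a b *\<^sub>R b) \<in> K \<and> g (\<Sum>b\<in>A. a b *\<^sub>R b) = f (\<Sum>b\<in>A. a b *\<^sub>R b)"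
    if "A \<subseteq> B" "\<And>b. 0 \<le> a b" for A a
    using finite_subset[OF that(1) fin] that(1)
  proof (induction A rule: finite_induct)
    case empty
    then show ?case using zero g(1) by (simp add: linear_0)
  next
    case (insert b A)
    then have "b \<in> K" "g b = f b" using B(1) g(2) by auto
    then show ?case using insert that(2) g(1)
      by (auto simp: linear_add linear_scale f_add f_scale scale add)
  qed
  show thesis
  proof (rule that[OF g(1)])
    fix u assume u: "u \<in> K"
    then obtain c where c: "u = (\<Sum>b\<in>B. c b *\<^sub>R b)" using B(3) span_finite[OF fin] by auto
    \<comment> \<open>Positive and negative parts of the coefficients. The identity
      \<open>u + q = p\<close> stays inside \<open>K\<close>, where \<open>f\<close> is
      additive.\<close>
    define p where "p = (\<Sum>b\<in>B. max (c b) 0 *\<^sub>R b)"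
    define q where "q = (\<Sum>b\<in>B. max (- c b) 0 *\<^sub>R b)"
    have "u + q = p" unfolding c p_def q_def sum.distrib[symmetric] scaleR_add_left[symmetric]
      by (intro sum.cong refl arg_cong2[where f=scaleR]) (simp add: max_def)
    moreover have "p \<in> K" "g p = f p" "q \<in> K" "g q = f q"
      unfolding p_def q_def using comb[OF order.refl] by auto
    ultimately have "g u + g q = f u + g q" using f_add[OF u, of q] linear_add[OF g(1), of u q] by simp
    then show "g u = f u" by simp
  qed
qed

section \<open>Measures carried by a cone\<close>

text \<open>The complement of the support is a union of open null sets, and countably many of them
  suffice by Lindelof.\<close>

lemma AE_in_Supp:
  assumes "M \<in> distributions"
  shows "AE x in M. x \<in> Supp M"
proof -
  have M: "sets M = sets borel" using assms by (rule distributionsD)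
  define \<U> where "\<U> = {U. open U \<and> emeasure M U = 0}"
  have eq: "- Supp M = \<Union> \<U>" by (auto simp: Supp_def \<U>_def)
  obtain \<V> where \<V>: "\<V> \<subseteq> \<U>" "countable \<V>" "\<Union> \<V> = \<Union> \<U>"
    by (rule Lindelof[of \<U>]) (auto simp: \<U>_def)
  have "(\<Union>U\<in>\<V>. U) \<in> null_sets M"
    using \<V> M by (intro null_sets_UN' ) (auto simp: \<U>_def null_sets_def)
  then have "\<Union> \<V> \<in> null_sets M" by simp
  then show ?thesis
    by (rule AE_I') (use eq \<V>(3) in auto)
qed

text \<open>A support point outside \<open>K\<close> could be strictly separated from
  \<open>K\<close>. As \<open>K\<close> is a cone, the separating half-space may be bounded by a
  hyperplane through 0, and then the open set on the far side has both positive and zero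
  mass.\<close>

lemma AE_in_cone_if_halfspaces:
  fixes K :: "'a::euclidean_space set"
  assumes K: "closed K" "convex K" "cone K" "K \<noteq> {}" and M: "M \<in> distributions"
    and half: "\<And>a. (\<And>x. x \<in> K \<Longrightarrow> 0 \<le> a \<bullet> x) \<Longrightarrow> AE x in M. 0 \<le> a \<bullet> x"
  shows "AE x in M. x \<in> K"
proof -
  have sets[measurable_cong]: "sets M = sets borel" using M by (rule distributionsD)
  have "Supp M \<subseteq> K"
  proof (rule ccontr)
    assume "\<not> Supp M \<subseteq> K"
    then obtain x where x: "x \<in> Supp M" "x \<notin> K" by auto
    obtain a c where a: "a \<bullet> x < c" "\<And>y. y \<in> K \<Longrightarrow> c < a \<bullet> y"
      using separating_hyperplane_closed_point[OF K(2,1) x(2)] by auto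
    have "0 \<in> K" using K(3,4) cone_contains_0 by blast
    then have c: "c < 0" using a(2) by force
    \<comment> \<open>Otherwise the positive multiple of \<open>y\<close> by
      \<open>c / (a \<bullet> y)\<close> would lie in \<open>K\<close> and have inner product
      exactly \<open>c\<close> with \<open>a\<close>.\<close>
    have "0 \<le> a \<bullet> y" if y: "y \<in> K" for y
    proof (rule ccontr)
      assume neg: "\<not> 0 \<le> a \<bullet> y"
      with c have "(c / (a \<bullet> y)) *\<^sub>R y \<in> K"
        by (intro mem_cone K y) (simp add: zero_le_divide_iff)
      with a(2) neg show False by force
    qed
    then have "AE y in M. 0 \<le> a \<bullet> y" by (rule half)
    then have "emeasure M {y \<in> space M. \<not> 0 \<le> a \<bullet> y} = 0"
      by (subst (asm) AE_iff_measurable[OF _ refl]) auto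
    then have "emeasure M {y. a \<bullet> y < 0} = 0" using M by (simp add: distributionsD not_le)
    moreover have "open {y. a \<bullet> y < 0}" by (rule open_halfspace_lt)
    moreover have "x \<in> {y. a \<bullet> y < 0}" using a(1) c by simp
    ultimately show False using x(1) by (auto simp: Supp_def)
  qed
  with AE_in_Supp[OF M] show ?thesis by auto
qed

section \<open>Half-spaces under convolution\<close>

lemma emeasure_convolution_ge:
  assumes M: "M \<in> distributions" and N: "N \<in> distributions"
    and [measurable]: "A \<in> sets borel" "B \<in> sets borel" "C \<in> sets borel"
    and sub: "\<And>x y. x \<in> A \<Longrightarrow> y \<in> B \<Longrightarrow> x + y \<in> C"
  shows "emeasure M A * emeasure N B \<le> emeasure (M \<star> N) C"
proof -
  have [measurable_cong]: "sets M = sets borel" "sets N = sets borel" using M N by (auto dest: distributionsD)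
  interpret pair_prob_space M N
    using M N by (simp add: pair_prob_space_def pair_sigma_finite_def distributionsD(1)
      prob_space_imp_sigma_finite)
  have "emeasure M A * emeasure N B = emeasure (M \<Otimes>\<^sub>M N) (A \<times> B)"
    by (simp add: M2.emeasure_pair_measure_Times)
  also have "\<dots> \<le> emeasure (M \<Otimes>\<^sub>M N) ((\<lambda>(x, y). x + y) -` C \<inter> space (M \<Otimes>\<^sub>M N))"
    using sub M N
    by (intro emeasure_mono measurable_sets[OF _ \<open>C \<in> sets borel\<close>]) (auto simp: space_pair_measure distributionsD)
  also have "\<dots> = emeasure (M \<star> N) C"
    unfolding convolution_def by (subst emeasure_distr) auto
  finally show ?thesis .
qed

lemma AE_halfspace_iff:
  fixes a :: "'a::euclidean_space"
  assumes "M \<in> distributions"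
  shows "(AE x in M. 0 \<le> a \<bullet> x) \<longleftrightarrow> emeasure M {x. a \<bullet> x < 0} = 0"
proof -
  have [measurable_cong]: "sets M = sets borel" using assms by (rule distributionsD)
  show ?thesis
    by (subst AE_iff_measurable[OF _ refl]) (auto simp: distributionsD[OF assms] not_le)
qed

text \<open>If \<open>N\<close> charges the open half-space below 0, then so does a sum of
  \<open>n > 0\<close> independent copies.\<close>

lemma AE_halfspace_conv_root:
  assumes N: "N \<in> distributions" and "0 < n"
    and half: "AE x in conv_power N n. 0 \<le> a \<bullet> x"
  shows "AE x in N. 0 \<le> a \<bullet> x"
proof (rule ccontr)
  assume "\<not> (AE x in N. 0 \<le> a \<bullet> x)"
  then have pos: "0 < emeasure N {x. a \<bullet> x < 0}"
    by (simp add: AE_halfspace_iff[OF N] zero_less_iff_neq_zero)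
  \<comment> \<open>One summand in the open half-space moves a sum from the closed half-space into
    the open one. The closed one starts the induction, since the zeroth power sits at 0.\<close>
  have step: "0 < emeasure (conv_power N (Suc n)) {x. a \<bullet> x < 0}"
    if "0 < emeasure (conv_power N n) {x. a \<bullet> x \<le> 0}" for n
  proof -
    have "emeasure N {x. a \<bullet> x < 0} * emeasure (conv_power N n) {x. a \<bullet> x \<le> 0}
        \<le> emeasure (N \<star> conv_power N n) {x. a \<bullet> x < 0}"
      by (rule emeasure_convolution_ge[OF N conv_power_distributions[OF N]])
        (auto simp: inner_add_right)
    moreover have "0 < emeasure N {x. a \<bullet> x < 0} * emeasure (conv_power N n) {x. a \<bullet> x \<le> 0}"
      using pos that by (simp add: ennreal_zero_less_mult_iff)
    ultimately show ?thesis by simp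
  qed
  have le: "0 < emeasure (conv_power N m) {x. a \<bullet> x \<le> 0}" for m
  proof (induction m)
    case (Suc m)
    from step[OF Suc] have "0 < emeasure (conv_power N (Suc m)) {x. a \<bullet> x < 0}" .
    also have "\<dots> \<le> emeasure (conv_power N (Suc m)) {x. a \<bullet> x \<le> 0}"
      by (rule emeasure_mono) (auto simp: distributionsD[OF conv_power_distributions[OF N]])
    finally show ?case .
  qed simp
  obtain m where "n = Suc m" using \<open>0 < n\<close> by (cases n) auto
  with step[OF le[of m]] half show False
    by (simp add: AE_halfspace_iff[OF conv_power_distributions[OF N]])
qed

text \<open>If \<open>M'\<close> charges \<open>{x. a \<bullet> x < - \<delta>}\<close> and \<open>M\<close> charges \<open>{x. a \<bullet> x < s}\<close>, then \<open>s > 0\<close> and \<open>M\<close>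
  also charges \<open>{x. a \<bullet> x < c * s - \<delta>}\<close>, hence \<open>{x. a \<bullet> x < s - \<delta>}\<close>. Iterating contradicts \<open>s > 0\<close>.\<close>

lemma AE_halfspace_conv_factor:
  fixes a :: "'a::ordered_euclidean_space"
  assumes M: "M \<in> distributions" and M': "M' \<in> distributions" and c: "0 < c" "c < 1"
    and conv: "M = (distr M borel ((*\<^sub>R) c) \<star> M')" and half: "AE x in M. 0 \<le> a \<bullet> x"
  shows "AE x in M'. 0 \<le> a \<bullet> x"
proof (rule ccontr)
  assume contr: "\<not> (AE x in M'. 0 \<le> a \<bullet> x)"
  have [measurable_cong]: "sets M = sets borel" "sets M' = sets borel" using M M' by (auto dest: distributionsD)
  \<comment> \<open>Countable additivity turns positive mass below 0 into positive mass below a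
    fixed negative level.\<close>
  obtain \<delta> where \<delta>: "0 < \<delta>" "0 < emeasure M' {x. a \<bullet> x < - \<delta>}"
  proof (rule ccontr)
    assume "\<not> thesis"
    with that have null: "emeasure M' {x. a \<bullet> x < - \<delta>} = 0" if "0 < \<delta>" for \<delta>
      using \<open>0 < \<delta>\<close> by (auto simp: zero_less_iff_neq_zero)
    have "AE x in M'. \<not> a \<bullet> x < - (1 / real (Suc n))" for n
      using null[of "1 / real (Suc n)"]
      by (subst AE_iff_measurable[OF _ refl]) (auto simp: distributionsD[OF M'] simp del: of_nat_Suc)
    then have "AE x in M'. \<forall>n. \<not> a \<bullet> x < - (1 / real (Suc n))" unfolding AE_all_countable by blast
    then have "AE x in M'. 0 \<le> a \<bullet> x"
    proof eventually_elim
      case (elim x)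
      show ?case
      proof (rule ccontr)
        assume "\<not> 0 \<le> a \<bullet> x"
        then obtain n where "1 / real (Suc n) < - (a \<bullet> x)" using nat_approx_posE[of "- (a \<bullet> x)"] by auto
        with elim[THEN spec, of n] show False by linarith
      qed
    qed
    with contr show False by contradiction
  qed
  define G where "G s \<longleftrightarrow> 0 < emeasure M {x. a \<bullet> x < s}" for s
  have pos: "0 < s" if "G s" for s
  proof (rule ccontr)
    assume "\<not> 0 < s"
    then have "emeasure M {x. a \<bullet> x < s} \<le> emeasure M {x. a \<bullet> x < 0}"
      by (intro emeasure_mono) auto
    with half that show False by (simp add: G_def AE_halfspace_iff[OF M])
  qed
  have step: "G (s - \<delta>)" if s: "G s" for s
  proof -
    have "0 < emeasure M {x. a \<bullet> x < s} * emeasure M' {x. a \<bullet> x < - \<delta>}"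
      using s \<delta> by (simp add: G_def ennreal_zero_less_mult_iff)
    also have "emeasure M {x. a \<bullet> x < s} = emeasure (distr M borel ((*\<^sub>R) c)) {x. a \<bullet> x < c * s}"
      using c by (subst emeasure_distr) (auto simp: distributionsD[OF M] vimage_def)
    also have "\<dots> * emeasure M' {x. a \<bullet> x < - \<delta>} \<le> emeasure (distr M borel ((*\<^sub>R) c) \<star> M') {x. a \<bullet> x < s - \<delta>}"
    proof (rule emeasure_convolution_ge[OF distr_distributions[OF M] M'])
      fix x y assume xy: "x \<in> {x. a \<bullet> x < c * s}" "y \<in> {x. a \<bullet> x < - \<delta>}"
      have "c * s \<le> s" using c pos[OF s] by simp
      with xy show "x + y \<in> {x. a \<bullet> x < s - \<delta>}" by (simp add: inner_add_right)
    qed auto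
    finally show ?thesis unfolding G_def conv[symmetric] .
  qed
  \<comment> \<open>The half-spaces \<open>a \<bullet> x < n\<close> exhaust the space, so one of
    them is charged.\<close>
  obtain s where s: "G s"
  proof (rule ccontr)
    assume "\<not> thesis"
    with that have "\<not> G (real n)" for n by blast
    then have "emeasure M {x. a \<bullet> x < real n} = 0" for n by (simp add: G_def zero_less_iff_neq_zero)
    then have "AE x in M. \<not> a \<bullet> x < real n" for n
      by (subst AE_iff_measurable[OF _ refl]) (auto simp: distributionsD[OF M])
    then have "AE x in M. \<forall>n. \<not> a \<bullet> x < real n" unfolding AE_all_countable by blast
    then have "AE x in M. False" by eventually_elim (use reals_Archimedean2 in blast)
    with prob_space.AE_False[OF distributionsD(1)[OF M]] show False by simp
  qed
  have "G (s - real n * \<delta>)" for n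
  proof (induction n)
    case (Suc n)
    from step[OF this] show ?case by (simp add: algebra_simps)
  qed (use s in simp)
  moreover obtain n :: nat where "s < real n * \<delta>" using reals_Archimedean3[OF \<delta>(1)] by blast
  ultimately show False using pos by (metis diff_less_0_iff_less order_less_asym)
qed

section \<open>Complex integrals of mixtures and weak limits\<close>

lemma integral_bind_complex:
  fixes f :: "'a::euclidean_space \<Rightarrow> complex"
  assumes f[measurable]: "f \<in> borel_measurable borel" and bdd: "\<And>x. norm (f x) \<le> C"
    and k: "k \<in> borel \<rightarrow>\<^sub>M prob_algebra borel" and M: "M \<in> distributions"
  shows "(\<integral>x. f x \<partial>(M \<bind> k)) = (\<integral>u. (\<integral>x. f x \<partial>k u) \<partial>M)"
proof -
  have [measurable_cong]: "sets M = sets borel" using M by (rule distributionsD)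
  have k'[measurable]: "k \<in> M \<rightarrow>\<^sub>M subprob_algebra borel"
    using measurable_prob_algebraD[OF k] by (simp cong: measurable_cong_sets)
  have kd: "k u \<in> distributions" for u
    using measurable_space[OF k] by (simp add: distributions_eq_space_prob_algebra)
  have bd: "(M \<bind> k) \<in> distributions"
    using M k prob_space_bind'[of M borel k] sets_bind'[of M borel k]
    by (auto simp: distributions_eq_space_prob_algebra space_prob_algebra)
  have int: "integrable N f" if "N \<in> distributions" for N
    using that f bdd by (rule integrable_bounded_measurable)
  interpret prob_space M using M by (rule distributionsD)
  have real: "(\<integral>x. g x \<partial>(M \<bind> k)) = (\<integral>u. (\<integral>x. g x \<partial>k u) \<partial>M)"
    if [measurable]: "g \<in> borel_measurable borel" and "\<And>x. \<bar>g x\<bar> \<le> C" for g :: "'a \<Rightarrow> real"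
    using that by (intro integral_bind[where B=C and B'=1 and K=borel])
      (auto simp: prob_space.emeasure_space_1[OF distributionsD(1)[OF kd]] finite_measure_axioms)
  \<comment> \<open>Integrability in \<open>u\<close> permits taking real and imaginary parts under
    the outer integral.\<close>
  have outer: "integrable M (\<lambda>u. \<integral>x. f x \<partial>k u)"
  proof (rule integrable_const_bound[of _ C])
    show "AE u in M. norm (\<integral>x. f x \<partial>k u) \<le> C"
    proof (rule AE_I2)
      fix u
      interpret k: prob_space "k u" using kd by (rule distributionsD)
      have "norm (\<integral>x. f x \<partial>k u) \<le> (\<integral>x. norm (f x) \<partial>k u)" by (rule integral_norm_bound)
      also have "\<dots> \<le> (\<integral>x. C \<partial>k u)" using bdd int[OF kd] by (intro integral_mono) auto
      finally show "norm (\<integral>x. f x \<partial>k u) \<le> C" by (simp add: k.prob_space)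
    qed
    have "(\<lambda>u. \<integral>x. f x \<partial>k u) = (\<lambda>u. Complex (\<integral>x. Re (f x) \<partial>k u) (\<integral>x. Im (f x) \<partial>k u))"
      using int[OF kd] by (simp add: complex_eq_iff fun_eq_iff)
    moreover have "(\<lambda>u. \<integral>x. Re (f x) \<partial>k u) \<in> borel_measurable M" "(\<lambda>u. \<integral>x. Im (f x) \<partial>k u) \<in> borel_measurable M"
      by (rule measurable_compose[OF k'], rule integral_measurable_subprob_algebra, measurable)+
    ultimately show "(\<lambda>u. \<integral>x. f x \<partial>k u) \<in> borel_measurable M"
      by (simp add: borel_measurable_complex_iff)
  qed
  show ?thesis
  proof (rule complex_eqI)
    have "Re (\<integral>x. f x \<partial>(M \<bind> k)) = (\<integral>x. Re (f x) \<partial>(M \<bind> k))" using int[OF bd] by simp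
    also have "\<dots> = (\<integral>u. (\<integral>x. Re (f x) \<partial>k u) \<partial>M)"
      using bdd order.trans[OF abs_Re_le_cmod] by (intro real) auto
    also have "\<dots> = Re (\<integral>u. (\<integral>x. f x \<partial>k u) \<partial>M)" using int[OF kd] outer by simp
    finally show "Re (\<integral>x. f x \<partial>(M \<bind> k)) = Re (\<integral>u. (\<integral>x. f x \<partial>k u) \<partial>M)" .
    have "Im (\<integral>x. f x \<partial>(M \<bind> k)) = (\<integral>x. Im (f x) \<partial>(M \<bind> k))" using int[OF bd] by simp
    also have "\<dots> = (\<integral>u. (\<integral>x. Im (f x) \<partial>k u) \<partial>M)"
      using bdd order.trans[OF abs_Im_le_cmod] by (intro real) auto
    also have "\<dots> = Im (\<integral>u. (\<integral>x. f x \<partial>k u) \<partial>M)" using int[OF kd] outer by simp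
    finally show "Im (\<integral>x. f x \<partial>(M \<bind> k)) = Im (\<integral>u. (\<integral>x. f x \<partial>k u) \<partial>M)" .
  qed
qed

text \<open>Real and imaginary parts are bounded continuous test functions. Splitting the integral
  uses integrability, supplied for eventually all \<open>i\<close>, which suits limits as time
  decreases to 0.\<close>

lemma weakly_tendsto_complex:
  fixes h :: "'a::euclidean_space \<Rightarrow> complex"
  assumes w: "weakly_tendsto M N F" and M: "\<forall>\<^sub>F i in F. M i \<in> distributions" and N: "N \<in> distributions"
    and h: "continuous_on UNIV h" "\<And>x. norm (h x) \<le> C"
  shows "((\<lambda>i. \<integral>x. h x \<partial>M i) \<longlongrightarrow> (\<integral>x. h x \<partial>N)) F"
proof -
  have int: "(\<integral>x. h x \<partial>P) = Complex (\<integral>x. Re (h x) \<partial>P) (\<integral>x. Im (h x) \<partial>P)" if "P \<in> distributions" for P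
    using integrable_bounded_measurable[OF that borel_measurable_continuous_onI[OF h(1)] h(2)]
    by (simp add: complex_eq_iff)
  have "((\<lambda>i. \<integral>x. g (h x) \<partial>M i) \<longlongrightarrow> (\<integral>x. g (h x) \<partial>N)) F"
    if g: "g = Re \<or> g = Im" for g
  proof -
    have "continuous_on UNIV (\<lambda>x. g (h x))" using g h(1) by (auto intro!: continuous_intros)
    moreover have "bounded (range (\<lambda>x. g (h x)))"
      using g h(2) by (intro boundedI[of _ C]) (auto intro: order.trans[OF abs_Re_le_cmod] order.trans[OF abs_Im_le_cmod])
    ultimately show ?thesis using w by (auto simp: weakly_tendsto_def)
  qed
  then have "((\<lambda>i. Complex (\<integral>x. Re (h x) \<partial>M i) (\<integral>x. Im (h x) \<partial>M i)) \<longlongrightarrow> (\<integral>x. h x \<partial>N)) F"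
    unfolding int[OF N] by (intro tendsto_Complex) auto
  then show ?thesis
    by (rule Lim_transform_eventually) (use M int in \<open>auto elim!: eventually_mono\<close>)
qed

section \<open>Subordination\<close>

locale cone_conv_semigroup =
  fixes K :: "'b::ordered_euclidean_space set" and \<mu> :: "'b \<Rightarrow> 'a::ordered_euclidean_space measure"
  assumes K: "param_cone K" and \<mu>: "conv_semigroup K \<mu>"
begin

lemma K_cone: "closed K" "convex K" "cone K" "K \<noteq> {}"
  using K by (auto simp: param_cone_def)

lemma K_add: "u \<in> K \<Longrightarrow> v \<in> K \<Longrightarrow> u + v \<in> K"
  using convex_cone[of K] K_cone by blast

lemma K_scale: "0 \<le> c \<Longrightarrow> u \<in> K \<Longrightarrow> c *\<^sub>R u \<in> K"
  using K_cone(3) mem_cone by blast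

lemma K_0: "0 \<in> K"
  using K_cone cone_contains_0 by blast

lemma \<mu>_distributions: "u \<in> K \<Longrightarrow> \<mu> u \<in> distributions"
  using \<mu> by (simp add: conv_semigroup_def)

lemma char_fun_add: "u \<in> K \<Longrightarrow> v \<in> K \<Longrightarrow> char_fun (\<mu> (u + v)) z = char_fun (\<mu> u) z * char_fun (\<mu> v) z"
  using \<mu> by (simp add: conv_semigroup_def flip: char_fun_convolution)

lemma scaled_measure_weakly_tendsto:
  "u \<in> K \<Longrightarrow> weakly_tendsto (\<lambda>t. \<mu> (t *\<^sub>R u)) (return borel 0) (at_right 0)"
  using \<mu> by (simp add: conv_semigroup_def)

lemma eventually_scaled_distributions: "u \<in> K \<Longrightarrow> \<forall>\<^sub>F t in at_right 0. \<mu> (t *\<^sub>R u) \<in> distributions"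
  by (auto simp: eventually_at_right_field intro!: exI[of _ 1] \<mu>_distributions K_scale)

text \<open>Along the ray through \<open>u\<close> the measures form a one-parameter semigroup with
  value \<open>\<mu> u\<close> at time 1; weak convergence is tested on exponentials.\<close>

lemma char_fun_scale:
  assumes u: "u \<in> K" and t: "0 \<le> t"
  shows "char_fun (\<mu> (t *\<^sub>R u)) z = char_pow (\<mu> u) t z"
proof -
  have "char_fun (\<mu> (t *\<^sub>R u)) z = char_pow (\<mu> (1 *\<^sub>R u)) t z"
  proof (rule char_fun_semigroup_eq_char_pow)
    fix z
    have "((\<lambda>t. \<integral>x. iexp (z \<bullet> x) \<partial>\<mu> (t *\<^sub>R u)) \<longlongrightarrow> (\<integral>x. iexp (z \<bullet> x) \<partial>return borel 0)) (at_right 0)"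
      by (rule weakly_tendsto_complex[OF scaled_measure_weakly_tendsto[OF u]
            eventually_scaled_distributions[OF u] return_0_distributions, where C=1])
        (auto intro!: continuous_intros)
    then show "((\<lambda>t. char_fun (\<mu> (t *\<^sub>R u)) z) \<longlongrightarrow> 1) (at_right 0)"
      by (simp add: char_fun_return_0 flip: char_fun_def)
  qed (use u t in \<open>auto simp: scaleR_add_left char_fun_add K_scale \<mu>_distributions\<close>)
  then show ?thesis by simp
qed

text \<open>Multiplicativity at one point gives this only modulo 2 pi i, so it is used along the
  whole ray through \<open>u + v\<close>.\<close>

lemma char_log_add:
  assumes "u \<in> K" "v \<in> K"
  shows "char_log (\<mu> (u + v)) z = char_log (\<mu> u) z + char_log (\<mu> v) z"
proof (rule complex_exp_semigroup_inject)
  fix t :: real assume "0 \<le> t"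
  then have "char_fun (\<mu> (t *\<^sub>R (u + v))) z = char_fun (\<mu> (t *\<^sub>R u)) z * char_fun (\<mu> (t *\<^sub>R v)) z"
    using assms by (simp add: scaleR_add_right char_fun_add K_scale)
  then show "exp (complex_of_real t * char_log (\<mu> (u + v)) z) =
      exp (complex_of_real t * (char_log (\<mu> u) z + char_log (\<mu> v) z))"
    using assms \<open>0 \<le> t\<close> by (simp add: char_fun_scale K_add char_pow_def exp_add distrib_left)
qed

lemma char_log_scale:
  assumes "u \<in> K" "0 \<le> c"
  shows "char_log (\<mu> (c *\<^sub>R u)) z = c *\<^sub>R char_log (\<mu> u) z"
proof (rule complex_exp_semigroup_inject)
  fix t :: real assume "0 \<le> t"
  with assms char_fun_scale[of "c *\<^sub>R u" t z] char_fun_scale[of u "t * c" z]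
  show "exp (complex_of_real t * char_log (\<mu> (c *\<^sub>R u)) z) = exp (complex_of_real t * (c *\<^sub>R char_log (\<mu> u) z))"
    by (simp add: K_scale char_pow_def scaleR_conv_of_real mult.assoc)
qed

text \<open>The exponential of the linear extension of the logarithm is continuous but may be large
  off \<open>K\<close>. Capping the real part of the exponent at 0 bounds it and changes nothing on
  \<open>K\<close>, where the modulus is at most 1 already.\<close>

lemma char_fun_extension:
  obtains h where "continuous_on UNIV h" "\<And>u. norm (h u) \<le> 1" "\<And>u. u \<in> K \<Longrightarrow> h u = char_fun (\<mu> u) z"
proof -
  obtain g where g: "linear g" "\<And>u. u \<in> K \<Longrightarrow> g u = char_log (\<mu> u) z"
    using additive_on_cone_imp_linear[of K "\<lambda>u. char_log (\<mu> u) z"]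
      K_cone(4) K_add K_scale char_log_add char_log_scale by blast
  have cont: "continuous_on UNIV g" using g(1) by (rule linear_continuous_on[OF linear_linear[THEN iffD2]])
  show thesis
  proof
    show "continuous_on UNIV (\<lambda>u. exp (Complex (min 0 (Re (g u))) (Im (g u))))"
      using cont by (auto simp: Complex_eq intro!: continuous_intros)
    show "norm (exp (Complex (min 0 (Re (g u))) (Im (g u)))) \<le> 1" for u by simp
    fix u assume u: "u \<in> K"
    have eq: "exp (g u) = char_fun (\<mu> u) z"
      using char_fun_scale[OF u, of 1 z] by (simp add: g(2)[OF u] char_pow_def)
    then have "norm (exp (g u)) \<le> 1" using norm_char_fun_le_1[OF \<mu>_distributions[OF u]] by simp
    then have "Complex (min 0 (Re (g u))) (Im (g u)) = g u" by (simp add: complex_eq_iff)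
    with eq show "exp (Complex (min 0 (Re (g u))) (Im (g u))) = char_fun (\<mu> u) z" by simp
  qed
qed

text \<open>One fixed extension for each \<open>z\<close>. Being bounded and continuous on the whole
  space, it is an admissible test function for weak convergence.\<close>

definition ext :: "'a \<Rightarrow> 'b \<Rightarrow> complex" where
  "ext z = (SOME h. continuous_on UNIV h \<and> (\<forall>u. norm (h u) \<le> 1) \<and> (\<forall>u\<in>K. h u = char_fun (\<mu> u) z))"

lemma ext:
  shows continuous_ext: "continuous_on UNIV (ext z)" and norm_ext: "norm (ext z u) \<le> 1"
    and ext_eq: "u \<in> K \<Longrightarrow> ext z u = char_fun (\<mu> u) z"
proof -
  have "\<exists>h. continuous_on UNIV h \<and> (\<forall>u. norm (h u) \<le> 1) \<and> (\<forall>u\<in>K. h u = char_fun (\<mu> u) z)"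
    by (rule char_fun_extension[of z]) blast
  from someI_ex[OF this] show "continuous_on UNIV (ext z)" "norm (ext z u) \<le> 1"
    "u \<in> K \<Longrightarrow> ext z u = char_fun (\<mu> u) z"
    by (auto simp: ext_def)
qed

lemma ext_measurable[measurable]: "ext z \<in> borel_measurable borel"
  by (intro borel_measurable_continuous_onI continuous_ext)

text \<open>The default \<open>return borel 0\<close> off \<open>K\<close> makes this a probability
  kernel on the whole space.\<close>

definition kern :: "'b \<Rightarrow> 'a measure" where
  "kern u = (if u \<in> K then \<mu> u else return borel 0)"

lemma kern_measurable: "kern \<in> borel \<rightarrow>\<^sub>M prob_algebra borel"
proof (rule kernel_measurable_char_fun)
  have [measurable]: "K \<in> sets borel" using K_cone(1) by simp
  show "(\<lambda>u. char_fun (kern u) z) \<in> borel_measurable borel" for z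
  proof -
    have "(\<lambda>u. char_fun (kern u) z) = (\<lambda>u. if u \<in> K then ext z u else 1)"
      by (auto simp: kern_def ext_eq char_fun_return_0)
    then show ?thesis by simp
  qed
qed (simp add: kern_def \<mu>_distributions return_0_distributions)

definition subord :: "'b measure \<Rightarrow> 'a measure" where
  "subord \<nu> = \<nu> \<bind> kern"

lemma subord_distributions: "\<nu> \<in> distributions \<Longrightarrow> subord \<nu> \<in> distributions"
  using prob_space_bind'[OF _ kern_measurable] sets_bind'[OF _ kern_measurable]
  by (auto simp: subord_def distributions_eq_space_prob_algebra space_prob_algebra)

text \<open>Connects the monadic bind with the integral over the cone that defines
  subordination.\<close>

lemma emeasure_subord:
  assumes \<nu>: "\<nu> \<in> distributions" "AE u in \<nu>. u \<in> K" and B: "B \<in> sets borel"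
  shows "emeasure (subord \<nu>) B = (\<integral>\<^sup>+u\<in>K. emeasure (\<mu> u) B \<partial>\<nu>)"
proof -
  have "emeasure (subord \<nu>) B = (\<integral>\<^sup>+u. emeasure (kern u) B \<partial>\<nu>)"
    unfolding subord_def using \<nu>(1) kern_measurable B
    by (intro emeasure_bind_prob_algebra) (simp_all add: distributions_eq_space_prob_algebra)
  also have "\<dots> = (\<integral>\<^sup>+u\<in>K. emeasure (\<mu> u) B \<partial>\<nu>)"
  proof (rule nn_integral_cong_AE)
    show "AE u in \<nu>. emeasure (kern u) B = emeasure (\<mu> u) B * indicator K u"
      using \<nu>(2) by eventually_elim (simp add: kern_def)
  qed
  finally show ?thesis .
qed

lemma char_fun_subord:
  assumes \<nu>: "\<nu> \<in> distributions" "AE u in \<nu>. u \<in> K"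
  shows "char_fun (subord \<nu>) z = (\<integral>u. ext z u \<partial>\<nu>)"
proof -
  have [measurable_cong]: "sets \<nu> = sets borel" using \<nu>(1) by (rule distributionsD)
  have [measurable]: "K \<in> sets borel" using K_cone(1) by simp
  have "char_fun (subord \<nu>) z = (\<integral>u. char_fun (kern u) z \<partial>\<nu>)"
    unfolding char_fun_def subord_def
    by (rule integral_bind_complex[OF _ _ kern_measurable \<nu>(1), where C=1]) auto
  also have "\<dots> = (\<integral>u. (if u \<in> K then ext z u else 1) \<partial>\<nu>)"
    by (rule Bochner_Integration.integral_cong) (auto simp: kern_def ext_eq char_fun_return_0)
  also have "\<dots> = (\<integral>u. ext z u \<partial>\<nu>)"
    using \<nu>(2) by (intro integral_cong_AE) (auto elim!: eventually_mono)
  finally show ?thesis .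
qed

lemma char_fun_subord_convolution:
  assumes "\<nu>1 \<in> distributions" "\<nu>2 \<in> distributions" "AE u in \<nu>1. u \<in> K" "AE u in \<nu>2. u \<in> K"
    and "AE u in (\<nu>1 \<star> \<nu>2). u \<in> K"
  shows "char_fun (subord (\<nu>1 \<star> \<nu>2)) z = char_fun (subord \<nu>1) z * char_fun (subord \<nu>2) z"
  unfolding char_fun_subord[OF assms(1,3)] char_fun_subord[OF assms(2,4)]
    char_fun_subord[OF convolution_distributions[OF assms(1,2)] assms(5)]
  by (rule integral_convolution_mult[OF assms(1,2) ext_measurable norm_ext assms(3,4)])
    (simp add: ext_eq K_add char_fun_add)

text \<open>Since \<open>K\<close> is closed under addition, the mass of \<open>K\<close> under the
  convolution is at least the product of two masses equal to 1.\<close>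

lemma AE_convolution_K:
  assumes "\<nu>1 \<in> distributions" "\<nu>2 \<in> distributions" "AE u in \<nu>1. u \<in> K" "AE u in \<nu>2. u \<in> K"
  shows "AE u in (\<nu>1 \<star> \<nu>2). u \<in> K"
proof -
  have [measurable]: "K \<in> sets borel" using K_cone(1) by simp
  have conv: "(\<nu>1 \<star> \<nu>2) \<in> distributions" using assms(1,2) by (rule convolution_distributions)
  interpret c: prob_space "\<nu>1 \<star> \<nu>2" using conv by (rule distributionsD)
  have "emeasure \<nu> K = 1" if "\<nu> \<in> distributions" "AE u in \<nu>. u \<in> K" for \<nu>
    using prob_space.emeasure_eq_1_AE[OF distributionsD(1)[OF that(1)] _ that(2)]
    by (simp add: distributionsD[OF that(1)])
  then have "1 \<le> emeasure (\<nu>1 \<star> \<nu>2) K"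
    using emeasure_convolution_ge[OF assms(1,2), of K K K] K_add assms by simp
  then have "c.prob K = 1" using c.prob_le_1[of K] by (simp add: c.emeasure_eq_measure)
  then show ?thesis using c.AE_prob_1 by blast
qed

lemma AE_return_0_K: "AE u in return borel 0. u \<in> K"
proof -
  have [measurable]: "K \<in> sets borel" using K_cone(1) by simp
  show ?thesis using K_0 by (subst AE_return) auto
qed

lemma AE_conv_power_K:
  assumes "\<nu> \<in> distributions" "AE u in \<nu>. u \<in> K"
  shows "AE u in conv_power \<nu> n. u \<in> K"
proof (induction n)
  case 0
  show ?case unfolding conv_power.simps by (rule AE_return_0_K)
next
  case (Suc n)
  then show ?case
    unfolding conv_power.simps by (intro AE_convolution_K conv_power_distributions assms)
qed

lemma char_fun_subord_conv_power:
  assumes "\<nu> \<in> distributions" "AE u in \<nu>. u \<in> K"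
  shows "char_fun (subord (conv_power \<nu> n)) z = char_fun (subord \<nu>) z ^ n"
proof (induction n)
  case 0
  \<comment> \<open>The zeroth convolution power is the point mass at 0, whose subordinated measure
    has the characteristic function of \<open>\<mu> 0\<close>.\<close>
  have "char_fun (\<mu> 0) z = 1" using char_fun_scale[OF K_0, of 0 z] by (simp add: char_pow_def)
  then show ?case
    using K_0 by (simp add: char_fun_subord return_0_distributions AE_return_0_K integral_return ext_eq)
next
  case (Suc n)
  note * = assms(1) conv_power_distributions[OF assms(1)] assms(2) AE_conv_power_K[OF assms]
  show ?case
    by (simp add: char_fun_subord_convolution[OF * AE_convolution_K[OF *]] Suc)
qed

text \<open>A convolution root of \<open>\<nu>\<close> is again carried by \<open>K\<close>, by the
  half-space criterion, and subordinating it gives a root of \<open>subord \<nu>\<close>.\<close>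

lemma subord_ID:
  assumes "\<nu> \<in> ID" and K: "AE u in \<nu>. u \<in> K"
  shows "subord \<nu> \<in> ID"
proof -
  have \<nu>: "\<nu> \<in> distributions" using assms(1) by (simp add: ID_def)
  have "\<exists>N\<in>distributions. conv_power N n = subord \<nu>" if n: "0 < n" for n
  proof -
    obtain N where N: "N \<in> distributions" "conv_power N n = \<nu>" using assms(1) n by (auto simp: ID_def)
    have NK: "AE u in N. u \<in> K"
      using K_cone N(1)
    proof (rule AE_in_cone_if_halfspaces)
      fix a assume "\<And>x. x \<in> K \<Longrightarrow> 0 \<le> a \<bullet> x"
      then have "AE x in conv_power N n. 0 \<le> a \<bullet> x" using K N(2) by (auto elim!: eventually_mono)
      then show "AE x in N. 0 \<le> a \<bullet> x" by (rule AE_halfspace_conv_root[OF N(1) n])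
    qed
    have "conv_power (subord N) n = subord (conv_power N n)"
      using N(1) NK
      by (intro char_fun_inject)
        (simp_all add: conv_power_distributions subord_distributions char_fun_conv_power char_fun_subord_conv_power)
    then show ?thesis using N subord_distributions by auto
  qed
  then show ?thesis using subord_distributions[OF \<nu>] by (simp add: ID_def)
qed

section \<open>Dilations and semistability\<close>

lemma AE_distr_scaleR_K:
  assumes "\<nu> \<in> distributions" "AE u in \<nu>. u \<in> K" "0 \<le> c"
  shows "AE u in distr \<nu> borel ((*\<^sub>R) c). u \<in> K"
proof -
  have [measurable_cong]: "sets \<nu> = sets borel" using assms(1) by (rule distributionsD)
  show ?thesis using assms K_cone(1) by (subst AE_distr_iff) (auto elim!: eventually_mono intro: K_scale)
qed

text \<open>The hypothesis trades a dilation of \<open>z\<close> for a dilation of the parameter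
  \<open>u\<close>; a change of variables moves the latter onto \<open>\<nu>\<close>.\<close>

lemma char_fun_subord_dilation:
  assumes \<nu>: "\<nu> \<in> distributions" "AE u in \<nu>. u \<in> K" and b: "0 \<le> b"
    and stable: "\<And>u. u \<in> K \<Longrightarrow> char_fun (\<mu> u) (r *\<^sub>R z) = char_fun (\<mu> (b *\<^sub>R u)) z"
  shows "char_fun (subord \<nu>) (r *\<^sub>R z) = char_fun (subord (distr \<nu> borel ((*\<^sub>R) b))) z"
proof -
  have [measurable_cong]: "sets \<nu> = sets borel" using \<nu>(1) by (rule distributionsD)
  have "char_fun (subord (distr \<nu> borel ((*\<^sub>R) b))) z = (\<integral>u. ext z u \<partial>distr \<nu> borel ((*\<^sub>R) b))"
    using \<nu> b by (intro char_fun_subord distr_distributions AE_distr_scaleR_K) auto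
  also have "\<dots> = (\<integral>u. ext z (b *\<^sub>R u) \<partial>\<nu>)" by (subst integral_distr) auto
  also have "\<dots> = (\<integral>u. ext (r *\<^sub>R z) u \<partial>\<nu>)"
    using \<nu>(2) by (intro integral_cong_AE) (auto elim!: eventually_mono simp: ext_eq K_scale b stable)
  also have "\<dots> = char_fun (subord \<nu>) (r *\<^sub>R z)" using \<nu> by (simp add: char_fun_subord)
  finally show ?thesis ..
qed

end

text \<open>Here \<open>r\<close> stands for \<open>b powr (1 / \<alpha>)\<close>. Semistability is
  expressed through members of the semigroup instead of real powers of characteristic
  functions.\<close>

locale stable_cone_conv_semigroup = cone_conv_semigroup +
  fixes b r :: real
  assumes b: "1 < b" and r: "0 < r"
    and stable: "\<And>u z. u \<in> K \<Longrightarrow> char_fun (\<mu> u) (r *\<^sub>R z) = char_fun (\<mu> (b *\<^sub>R u)) z"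
begin

text \<open>The factorization says that \<open>\<nu>\<close> is the convolution of its dilate
  \<open>\<nu>0\<close> by \<open>inverse b\<close> with \<open>\<nu>'\<close>. The half-space
  argument places \<open>\<nu>'\<close> on \<open>K\<close>; then the convolution is subordinated
  factor by factor.\<close>

lemma semi_sd_factor_subord:
  assumes \<nu>: "\<nu> \<in> distributions" "AE u in \<nu>. u \<in> K" and \<nu>': "\<nu>' \<in> distributions"
    and factor: "semi_sd_factor (inverse b) \<nu> \<nu>'"
  shows "AE u in \<nu>'. u \<in> K" "semi_sd_factor (inverse r) (subord \<nu>) (subord \<nu>')"
proof -
  define \<nu>0 where "\<nu>0 = distr \<nu> borel ((*\<^sub>R) (inverse b))"
  have c: "0 < inverse b" "inverse b < 1" using b by (auto simp: field_simps)
  have \<nu>0: "\<nu>0 \<in> distributions" unfolding \<nu>0_def using \<nu>(1) by (rule distr_distributions) simp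
  have \<nu>0K: "AE u in \<nu>0. u \<in> K" unfolding \<nu>0_def using c by (intro AE_distr_scaleR_K[OF \<nu>]) simp
  have conv: "\<nu> = (\<nu>0 \<star> \<nu>')"
  proof (rule char_fun_inject[OF \<nu>(1) convolution_distributions[OF \<nu>0 \<nu>']])
    show "char_fun \<nu> z = char_fun (\<nu>0 \<star> \<nu>') z" for z
      unfolding char_fun_convolution[OF \<nu>0 \<nu>'] unfolding \<nu>0_def char_fun_distr_scaleR[OF \<nu>(1)]
      by (rule factor[unfolded semi_sd_factor_def, rule_format])
  qed
  show \<nu>'K: "AE u in \<nu>'. u \<in> K"
    using K_cone \<nu>'
  proof (rule AE_in_cone_if_halfspaces)
    fix a assume "\<And>x. x \<in> K \<Longrightarrow> 0 \<le> a \<bullet> x"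
    then have "AE x in \<nu>. 0 \<le> a \<bullet> x" using \<nu>(2) by (auto elim!: eventually_mono)
    then show "AE x in \<nu>'. 0 \<le> a \<bullet> x"
      using AE_halfspace_conv_factor[OF \<nu>(1) \<nu>' c conv[unfolded \<nu>0_def]] by blast
  qed
  \<comment> \<open>Dilating \<open>\<nu>0\<close> by \<open>b\<close> restores
    \<open>\<nu>\<close>, so subordination makes \<open>subord \<nu>0\<close> the dilate of
    \<open>subord \<nu>\<close> by \<open>inverse r\<close>.\<close>
  have "distr \<nu>0 borel ((*\<^sub>R) b) = \<nu>"
    using \<nu>(1) \<nu>0 b by (intro char_fun_inject distr_distributions) (auto simp: char_fun_distr_scaleR \<nu>0_def)
  then have dil: "char_fun (subord \<nu>0) (r *\<^sub>R w) = char_fun (subord \<nu>) w" for w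
    using char_fun_subord_dilation[OF \<nu>0 \<nu>0K _ stable, of w] b by simp
  show "semi_sd_factor (inverse r) (subord \<nu>) (subord \<nu>')"
    unfolding semi_sd_factor_def
  proof
    fix z
    have "char_fun (subord \<nu>) z = char_fun (subord \<nu>0) z * char_fun (subord \<nu>') z"
      by (rule char_fun_subord_convolution[OF \<nu>0 \<nu>' \<nu>0K \<nu>'K, folded conv, OF \<nu>(2)])
    also have "char_fun (subord \<nu>0) z = char_fun (subord \<nu>) (inverse r *\<^sub>R z)"
      using dil[of "inverse r *\<^sub>R z"] r by simp
    finally show "char_fun (subord \<nu>) z = char_fun (subord \<nu>) (inverse r *\<^sub>R z) * char_fun (subord \<nu>') z" .
  qed
qed

lemma subord_semi_selfdecomposable:
  assumes "\<nu> \<in> semi_selfdecomposable (inverse b)" "AE u in \<nu>. u \<in> K"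
  shows "subord \<nu> \<in> semi_selfdecomposable (inverse r)"
proof -
  obtain \<nu>' where \<nu>': "\<nu> \<in> distributions" "\<nu>' \<in> ID" "semi_sd_factor (inverse b) \<nu> \<nu>'"
    using assms(1) by (auto simp: semi_selfdecomposable_def)
  then have "\<nu>' \<in> distributions" by (simp add: ID_def)
  note * = semi_sd_factor_subord[OF \<nu>'(1) assms(2) this \<nu>'(3)]
  show ?thesis
    unfolding semi_selfdecomposable_def
    using subord_distributions[OF \<nu>'(1)] subord_ID[OF \<nu>'(2) *(1)] *(2) by blast
qed

text \<open>The induction is over all measures carried by \<open>K\<close> because its hypothesis is
  applied to the factor \<open>\<nu>'\<close>, which is carried by \<open>K\<close> too.\<close>

lemma subord_L_fin:
  "\<nu> \<in> L_fin m (inverse b) \<Longrightarrow> AE u in \<nu>. u \<in> K \<Longrightarrow> subord \<nu> \<in> L_fin m (inverse r)"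
proof (induction m arbitrary: \<nu>)
  case 0
  then show ?case by (simp add: subord_semi_selfdecomposable)
next
  case (Suc m)
  then obtain \<nu>' where \<nu>': "\<nu> \<in> semi_selfdecomposable (inverse b)" "\<nu>' \<in> ID"
    "semi_sd_factor (inverse b) \<nu> \<nu>'" "\<nu>' \<in> L_fin m (inverse b)" by auto
  then have "\<nu> \<in> distributions" "\<nu>' \<in> distributions" by (simp_all add: ID_def semi_selfdecomposable_def)
  note * = semi_sd_factor_subord[OF this(1) Suc.prems(2) this(2) \<nu>'(3)]
  show ?case
    unfolding L_fin.simps
  proof (intro CollectI conjI bexI[of _ "subord \<nu>'"])
    show "subord \<nu> \<in> semi_selfdecomposable (inverse r)"
      by (rule subord_semi_selfdecomposable[OF \<nu>'(1) Suc.prems(2)])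
    show "semi_sd_factor (inverse r) (subord \<nu>) (subord \<nu>')" by (rule *(2))
    show "subord \<nu>' \<in> L_fin m (inverse r)" by (rule Suc.IH[OF \<nu>'(4) *(1)])
    show "subord \<nu>' \<in> ID" by (rule subord_ID[OF \<nu>'(2) *(1)])
  qed
qed

lemma subord_L_class:
  assumes "\<nu> \<in> L_class m (inverse b)" "AE u in \<nu>. u \<in> K"
  shows "subord \<nu> \<in> L_class m (inverse r)"
proof (cases m)
  case (enat n)
  then show ?thesis using assms subord_L_fin by (simp add: L_class_def)
next
  case infinity
  then have "\<nu> \<in> L_fin n (inverse b)" for n using assms(1) by (simp add: L_class_def)
  then show ?thesis using infinity subord_L_fin[OF _ assms(2)] by (simp add: L_class_def)
qed

end

section \<open>Transfer of both properties from the subordinator to the subordinated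
  semigroup\<close>

theorem theorem3p1:
  fixes K1 :: "(real ^ 'n1) set" and K2 :: "(real ^ 'n2) set"
    and \<mu> :: "real ^ 'n2 \<Rightarrow> (real ^ 'd) measure"
    and \<rho> :: "real ^ 'n1 \<Rightarrow> (real ^ 'n2) measure"
    and \<sigma> :: "real ^ 'n1 \<Rightarrow> (real ^ 'd) measure"
    and \<alpha> b :: real and s :: "real ^ 'n1"
  assumes "param_cone K1" and "param_cone K2"
    and "conv_semigroup K2 \<mu>"
    and "conv_semigroup K1 \<rho>" and "supported_on K1 \<rho> K2"
    and "subordinated K1 K2 \<mu> \<rho> \<sigma>"
    and "0 < \<alpha>" and "\<alpha> \<le> 2" and "1 < b"
    and "\<And>u. u \<in> K2 \<Longrightarrow> strictly_semistable \<alpha> (b powr (1 / \<alpha>)) (\<mu> u)"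
    and "s \<in> K1"
  shows "(\<forall>m::enat. \<rho> s \<in> L_class m (inverse b) \<longrightarrow>
            \<sigma> s \<in> L_class m (b powr (- (1 / \<alpha>)))) \<and>
         (\<forall>\<alpha>'. 0 < \<alpha>' \<and> \<alpha>' \<le> 1 \<and> strictly_semistable \<alpha>' b (\<rho> s) \<longrightarrow>
            strictly_semistable (\<alpha> * \<alpha>') (b powr (1 / \<alpha>)) (\<sigma> s))"
proof -
  define r where "r = b powr (1 / \<alpha>)"
  have r: "1 < r" "r powr \<alpha> = b"
    using assms(7,9) by (simp_all add: r_def powr_powr)
  interpret \<mu>: cone_conv_semigroup K2 \<mu>
    using assms(2,3) by unfold_locales
  interpret \<rho>: cone_conv_semigroup K1 \<rho>
    using assms(1,4) by unfold_locales
  \<comment> \<open>As \<open>r powr \<alpha> = b\<close>, semistability involves the real power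
    \<open>b\<close> of \<open>char_fun (\<mu> u)\<close>, which belongs to
    \<open>\<mu> (b *\<^sub>R u)\<close>.\<close>
  interpret \<mu>: stable_cone_conv_semigroup K2 \<mu> b r
  proof
    fix u z assume u: "u \<in> K2"
    have "char_pow (\<mu> u) b z = char_fun (\<mu> u) (r *\<^sub>R z)"
      using assms(10)[OF u] r(2) by (simp add: strictly_semistable_def flip: r_def)
    then show "char_fun (\<mu> u) (r *\<^sub>R z) = char_fun (\<mu> (b *\<^sub>R u)) z"
      using assms(9) by (simp add: \<mu>.char_fun_scale[OF u])
  qed (use r assms(9) in auto)
  have \<rho>K: "AE u in \<rho> v. u \<in> K2" if "v \<in> K1" for v
    using AE_in_Supp[OF \<rho>.\<mu>_distributions[OF that]]
  proof eventually_elim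
    case (elim u)
    then show ?case using assms(5) that by (auto simp: supported_on_def)
  qed
  have \<sigma>: "\<sigma> v = \<mu>.subord (\<rho> v)" if v: "v \<in> K1" for v
  proof (rule measure_eqI)
    note dist = \<rho>.\<mu>_distributions[OF v]
    show sets: "sets (\<sigma> v) = sets (\<mu>.subord (\<rho> v))"
      using assms(6) v distributionsD(2)[OF \<mu>.subord_distributions[OF dist]] by (simp add: subordinated_def)
    fix B assume "B \<in> sets (\<sigma> v)"
    then have "B \<in> sets borel" using assms(6) v by (simp add: subordinated_def)
    then show "emeasure (\<sigma> v) B = emeasure (\<mu>.subord (\<rho> v)) B"
      using assms(6) v by (simp add: subordinated_def \<mu>.emeasure_subord[OF dist \<rho>K[OF v]])
  qed
  note s = \<open>s \<in> K1\<close>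
  note \<rho>s = \<rho>.\<mu>_distributions[OF s]
  show ?thesis
  proof (intro conjI allI impI)
    fix m assume "\<rho> s \<in> L_class m (inverse b)"
    from \<mu>.subord_L_class[OF this \<rho>K[OF s]] show "\<sigma> s \<in> L_class m (b powr (- (1 / \<alpha>)))"
      by (simp add: \<sigma>[OF s] r_def powr_minus)
  next
    fix \<alpha>' assume "0 < \<alpha>' \<and> \<alpha>' \<le> 1 \<and> strictly_semistable \<alpha>' b (\<rho> s)"
    then have \<alpha>': "0 < \<alpha>'" "\<alpha>' \<le> 1" and ID: "\<rho> s \<in> ID"
      and stable: "\<And>w. char_pow (\<rho> s) (b powr \<alpha>') w = char_fun (\<rho> s) (b *\<^sub>R w)"
      by (auto simp: strictly_semistable_def)
    define t where "t = b powr \<alpha>'"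
    have t: "0 \<le> t" by (simp add: t_def)
    \<comment> \<open>By semistability of \<open>\<rho> s\<close>, both sides have the
      characteristic function \<open>char_fun (\<rho> s) (b *\<^sub>R w)\<close>.\<close>
    have "\<rho> (t *\<^sub>R s) = distr (\<rho> s) borel ((*\<^sub>R) b)"
      using \<rho>s stable
      by (intro char_fun_inject)
        (auto simp: \<rho>.\<mu>_distributions \<rho>.K_scale s t distr_distributions \<rho>.char_fun_scale
           char_fun_distr_scaleR simp flip: t_def)
    then have dil: "char_fun (\<sigma> (t *\<^sub>R s)) z = char_fun (\<sigma> s) (r *\<^sub>R z)" for z
      using \<mu>.char_fun_subord_dilation[OF \<rho>s \<rho>K[OF s] _ \<mu>.stable, of z] assms(9)
      by (simp add: \<sigma> s t \<rho>.K_scale)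
    \<comment> \<open>The measures \<open>\<sigma>\<close> on the ray through \<open>s\<close> form
      a one-parameter semigroup, so its member at time \<open>t\<close> realizes the real power. The
      factor 1 matches the form \<open>\<nu> 1\<close>.\<close>
    have "char_fun (\<sigma> (t *\<^sub>R s)) z = char_pow (\<sigma> (1 *\<^sub>R s)) t z" for z
    proof (rule char_fun_semigroup_eq_char_pow[OF _ _ _ t])
      show "\<sigma> (x *\<^sub>R s) \<in> distributions" if "0 \<le> x" for x
        using that by (simp add: \<sigma> s \<rho>.K_scale \<mu>.subord_distributions \<rho>.\<mu>_distributions)
      show "char_fun (\<sigma> ((x + y) *\<^sub>R s)) z = char_fun (\<sigma> (x *\<^sub>R s)) z * char_fun (\<sigma> (y *\<^sub>R s)) z"
        if "0 \<le> x" "0 \<le> y" for x y z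
      proof -
        have in_K1: "x *\<^sub>R s \<in> K1" "y *\<^sub>R s \<in> K1" "(x + y) *\<^sub>R s \<in> K1"
          using that s by (auto intro!: \<rho>.K_scale)
        have conv: "\<rho> ((x + y) *\<^sub>R s) = (\<rho> (x *\<^sub>R s) \<star> \<rho> (y *\<^sub>R s))"
          using assms(4) in_K1 by (simp add: conv_semigroup_def scaleR_add_left)
        show ?thesis
          unfolding \<sigma>[OF in_K1(1)] \<sigma>[OF in_K1(2)] \<sigma>[OF in_K1(3)] conv
          by (intro \<mu>.char_fun_subord_convolution \<rho>.\<mu>_distributions \<rho>K in_K1 \<rho>K[OF in_K1(3), unfolded conv])
      qed
      fix z
      \<comment> \<open>Weak convergence of \<open>\<rho>\<close> is tested on
        \<open>\<mu>.ext z\<close>; the limit is its value at 0, the characteristic function of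
        \<open>\<mu> 0\<close>.\<close>
      have "((\<lambda>x. \<integral>u. \<mu>.ext z u \<partial>\<rho> (x *\<^sub>R s)) \<longlongrightarrow> (\<integral>u. \<mu>.ext z u \<partial>return borel 0)) (at_right 0)"
        by (rule weakly_tendsto_complex[OF \<rho>.scaled_measure_weakly_tendsto[OF s]
              \<rho>.eventually_scaled_distributions[OF s] return_0_distributions \<mu>.continuous_ext \<mu>.norm_ext])
      also have "(\<integral>u. \<mu>.ext z u \<partial>return borel 0) = 1"
        using \<mu>.char_fun_scale[OF \<mu>.K_0, of 0 z] by (simp add: integral_return \<mu>.ext_eq \<mu>.K_0 char_pow_def)
      finally show "((\<lambda>x. char_fun (\<sigma> (x *\<^sub>R s)) z) \<longlongrightarrow> 1) (at_right 0)"
      proof (rule Lim_transform_eventually)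
        have "\<forall>\<^sub>F x::real in at_right 0. 0 < x" by (rule eventually_at_right_less)
        then show "\<forall>\<^sub>F x in at_right 0. (\<integral>u. \<mu>.ext z u \<partial>\<rho> (x *\<^sub>R s)) = char_fun (\<sigma> (x *\<^sub>R s)) z"
        proof eventually_elim
          case (elim x)
          then have "x *\<^sub>R s \<in> K1" using s by (simp add: \<rho>.K_scale)
          then show ?case by (simp add: \<sigma> \<mu>.char_fun_subord \<rho>.\<mu>_distributions \<rho>K)
        qed
      qed
    qed
    with dil have "char_pow (\<sigma> s) t z = char_fun (\<sigma> s) (r *\<^sub>R z)" for z by simp
    \<comment> \<open>The exponent law gives
      \<open>(r powr \<alpha>) powr \<alpha>' = b powr \<alpha>'\<close>, so the span
      \<open>r\<close> fits the index \<open>\<alpha> * \<alpha>'\<close>.\<close>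
    moreover have "r powr (\<alpha> * \<alpha>') = t" using r(2) by (simp add: t_def flip: powr_powr)
    moreover have "\<sigma> s \<in> ID" using \<mu>.subord_ID[OF ID \<rho>K[OF s]] by (simp add: \<sigma> s)
    moreover have "\<alpha> * \<alpha>' \<le> 2" using mult_mono[OF assms(8) \<alpha>'(2)] \<alpha>'(1) by simp
    ultimately show "strictly_semistable (\<alpha> * \<alpha>') (b powr (1 / \<alpha>)) (\<sigma> s)"
      using assms(7) \<alpha>'(1) r(1) by (simp add: strictly_semistable_def flip: r_def)
  qed
qed

end
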